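(* Consider the randomly switched system $\dot x = f_\sigma(x)$, $(x(0),\sigma(0))=(x_0,\sigma_0)$, $t\ge 0$. Suppose that: (E1) there exist continuously differentiable functions $V_i:\mathbb{R}^n\to\mathbb{R}$, $i\in\mathcal P$, functions $\alpha_1,\alpha_2\in\mathcal K_\infty$, and numbers $\mu>1$ and $\lambda_i\in\mathbb{R}$, $i\in\mathcal P$, such that for all $x\in\mathbb{R}^n$ and $i,j\in\mathcal P$: $\alpha_1(\|x\|)\le V_i(x)\le\alpha_2(\|x\|)$; $\langle\nabla V_i(x), f_i(x)\rangle\le -\lambda_i V_i(x)$; $V_i(x)\le\mu V_j(x)$; (E2) the switching signal $\sigma$ belongs to class EH with parameters $\lambda>0$ and $q_i\in[0,1]$, $i\in\mathcal P$; (E3) $\lambda_i+\lambda>0$ for all $i\in\mathcal P$; (E4) $\displaystyle\sum_{i\in\mathcal P}\frac{\mu q_i}{1+\lambda_i/\lambda}<1$. Then the system is globally asymptotically stable almost surely.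
   Context: Notation: $\mathbb{N}=\{1,2,\dots\}$, $\mathbb{N}_0=\mathbb{N}\cup\{0\}$, $\|\cdot\|$ is the Euclidean norm. A function $\alpha:[0,\infty[\to[0,\infty[$ is of class $\mathcal K$ if it is continuous, strictly increasing and $\alpha(0)=0$; it is of class $\mathcal K_\infty$ if in addition it is unbounded. Setting: $\mathcal P=\{1,\dots,\mathrm N\}$ is a finite index set; for each $i\in\mathcal P$ the vector field $f_i:\mathbb{R}^n\to\mathbb{R}^n$ is locally Lipschitz with $f_i(0)=0$. On a complete probability space $(\Omega,\mathfrak F,\mathsf P)$, the switching signal $\sigma=(\sigma(t))_{t\ge0}$ is a càdlàg $\mathcal P$-valued process with $\sigma(0)=\sigma_0$ deterministic. Its switching instants are $0=\tau_0<\tau_1<\tau_2<\cdots$ (almost surely); $\sigma$ is constant on each $[\tau_i,\tau_{i+1}[$, and $\sigma(\tau_i)=\sigma(\tau_{i-1})$ is allowed. The holding times are $S_i:=\tau_i-\tau_{i-1}$, $i\in\mathbb{N}$. The state $x$ does not jump at switching instants, and $x(\cdot)$ denotes the (pathwise, Carathéodory, absolutely continuous) solution of the switched system for the initial state $x_0$; it depends on $x_0$ and $\omega\in\Omega$. Class EH: $\sigma$ belongs to class EH if (EH1) $(S_i)_{i\in\mathbb{N}}$ is i.i.d., each $S_i$ exponential with parameter $\lambda>0$, i.e. $\mathsf P(S_i\le s)=1-e^{-\lambda s}$ for $s\ge0$; (EH2) there exist $q_i\in[0,1]$, $i\in\mathcal P$, such that for all $j\in\mathbb{N}$, $\mathsf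 P\big(\sigma(\tau_j)=i\,\big|\,(\sigma(\tau_k))_{k=0}^{j-1}\big)=q_i$; (EH3) the sequences $(S_i)_{i\in\mathbb{N}}$ and $(\sigma(\tau_i))_{i\in\mathbb{N}_0}$ are mutually independent. Global asymptotic stability almost surely means: (AS1) with probability one, for every $\varepsilon>0$ there is $\delta>0$ such that for every $x_0$, $\|x_0\|<\delta$ implies $\sup_{t\ge0}\|x(t)\|<\varepsilon$; and (AS2) with probability one, for all $r,\varepsilon'>0$ there is $T\ge0$ such that for every $x_0$, $\|x_0\|<r$ implies $\sup_{t\ge T}\|x(t)\|<\varepsilon'$. ($\delta$ and $T$ may depend on $\omega$.) *)

theory Defs
  imports "HOL-Probability.Probability"
begin

text \<open>The index set is \<open>{1..N}\<close>. A mode-indexed object such as the family of vector fields is a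
  function on \<open>nat\<close>, constrained only on \<open>{1..N}\<close>.\<close>

subsection \<open>Analytic notions\<close>

text \<open>Only the values on \<open>{0..}\<close> matter; nonnegativity there follows from monotonicity and
  \<open>\<alpha> 0 = 0\<close>.\<close>

definition class_K :: "(real \<Rightarrow> real) \<Rightarrow> bool" where
  "class_K \<alpha> \<longleftrightarrow> continuous_on {0..} \<alpha> \<and> strict_mono_on {0..} \<alpha> \<and> \<alpha> 0 = 0"

definition class_K_inf :: "(real \<Rightarrow> real) \<Rightarrow> bool" where
  "class_K_inf \<alpha> \<longleftrightarrow> class_K \<alpha> \<and> \<not> bdd_above (\<alpha> ` {0..})"

definition locally_lipschitz :: "('a::metric_space \<Rightarrow> 'b::metric_space) \<Rightarrow> bool" where
  "locally_lipschitz g \<longleftrightarrow> (\<forall>x. \<exists>u>0. \<exists>L. L-lipschitz_on (ball x u) g)"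

definition has_continuous_gradient :: "('a::real_inner \<Rightarrow> real) \<Rightarrow> ('a \<Rightarrow> 'a) \<Rightarrow> bool" where
  "has_continuous_gradient v g \<longleftrightarrow> (\<forall>x. GDERIV v x :> g x) \<and> continuous_on UNIV g"

text \<open>\<open>d division_of \<Union>d\<close> says that \<open>d\<close> is a finite set of nonempty compact intervals with disjoint
  interiors; \<open>Inf K\<close> and \<open>Sup K\<close> are the end points of \<open>K\<close>.\<close>

definition absolutely_continuous_fun_on :: "real set \<Rightarrow> (real \<Rightarrow> 'a::real_normed_vector) \<Rightarrow> bool" where
  "absolutely_continuous_fun_on I g \<longleftrightarrow>
     (\<forall>\<epsilon>>0. \<exists>\<delta>>0. \<forall>d. d division_of \<Union>d \<and> \<Union>d \<subseteq> I \<and> (\<Sum>K\<in>d. Sup K - Inf K) < \<delta> \<longrightarrow>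
        (\<Sum>K\<in>d. norm (g (Sup K) - g (Inf K))) < \<epsilon>)"

text \<open>Limits of \<open>nat\<close>-valued functions refer to the discrete topology.\<close>

definition cadlag :: "(real \<Rightarrow> 'a::topological_space) \<Rightarrow> bool" where
  "cadlag s \<longleftrightarrow> (\<forall>t\<ge>0. (s \<longlongrightarrow> s t) (at_right t)) \<and> (\<forall>t>0. \<exists>l. (s \<longlongrightarrow> l) (at_left t))"

subsection \<open>The switched system along a single path of the switching signal\<close>

text \<open>Caratheodory solutions on \<open>[0, T[\<close>, where \<open>T\<close> may be \<open>\<infinity>\<close>.\<close>

definition caratheodory_solution ::
  "(nat \<Rightarrow> 'a::real_normed_vector \<Rightarrow> 'a) \<Rightarrow> (real \<Rightarrow> nat) \<Rightarrow> 'a \<Rightarrow> ereal \<Rightarrow> (real \<Rightarrow> 'a) \<Rightarrow> bool" where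
  "caratheodory_solution f s x\<^sub>0 T x \<longleftrightarrow>
     x 0 = x\<^sub>0 \<and>
     (\<forall>b\<ge>0. ereal b < T \<longrightarrow> absolutely_continuous_fun_on {0..b} x) \<and>
     (AE t in lborel. 0 \<le> t \<and> ereal t < T \<longrightarrow> (x has_vector_derivative f (s t) (x t)) (at t))"

text \<open>For locally Lipschitz vector fields and a cadlag \<open>s\<close> the maximal solution exists for every
  initial state and is unique on its interval of existence, so it is the solution of the
  switched system. A priori it may explode in finite time.\<close>

definition maximal_solution ::
  "(nat \<Rightarrow> 'a::real_normed_vector \<Rightarrow> 'a) \<Rightarrow> (real \<Rightarrow> nat) \<Rightarrow> 'a \<Rightarrow> ereal \<Rightarrow> (real \<Rightarrow> 'a) \<Rightarrow> bool" where
  "maximal_solution f s x\<^sub>0 T x \<longleftrightarrow>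
     0 < T \<and> caratheodory_solution f s x\<^sub>0 T x \<and>
     \<not> (\<exists>T' y. T < T' \<and> caratheodory_solution f s x\<^sub>0 T' y \<and>
              (\<forall>t\<ge>0. ereal t < T \<longrightarrow> y t = x t))"

subsection \<open>Switching signals\<close>

text \<open>Holding times are indexed from 1.\<close>

definition holding_time :: "(nat \<Rightarrow> 'w \<Rightarrow> real) \<Rightarrow> nat \<Rightarrow> 'w \<Rightarrow> real" where
  "holding_time \<tau> i \<omega> = \<tau> i \<omega> - \<tau> (i - 1) \<omega>"

definition mode_at :: "(real \<Rightarrow> 'w \<Rightarrow> nat) \<Rightarrow> (nat \<Rightarrow> 'w \<Rightarrow> real) \<Rightarrow> nat \<Rightarrow> 'w \<Rightarrow> nat" where
  "mode_at \<sigma> \<tau> j \<omega> = \<sigma> (\<tau> j \<omega>) \<omega>"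

text \<open>Consecutive modes may coincide, so the \<open>\<tau> i\<close> cannot be recovered from \<open>\<sigma>\<close> and are part of
  the data.\<close>

definition (in prob_space) switching_signal ::
  "nat \<Rightarrow> nat \<Rightarrow> (real \<Rightarrow> 'a \<Rightarrow> nat) \<Rightarrow> (nat \<Rightarrow> 'a \<Rightarrow> real) \<Rightarrow> bool" where
  "switching_signal N \<sigma>\<^sub>0 \<sigma> \<tau> \<longleftrightarrow>
     (\<forall>t\<ge>0. random_variable (count_space {1..N}) (\<sigma> t)) \<and>
     (\<forall>\<omega>\<in>space M. \<sigma> 0 \<omega> = \<sigma>\<^sub>0 \<and> cadlag (\<lambda>t. \<sigma> t \<omega>)) \<and>
     (\<forall>i. random_variable borel (\<tau> i)) \<and>
     (AE \<omega> in M. \<tau> 0 \<omega> = 0 \<and> (\<forall>i. \<tau> i \<omega> < \<tau> (Suc i) \<omega>) \<and>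
        (\<forall>i. \<forall>t\<in>{\<tau> i \<omega>..<\<tau> (Suc i) \<omega>}. \<sigma> t \<omega> = \<sigma> (\<tau> i \<omega>) \<omega>))"

text \<open>The \<open>\<sigma>\<close>-algebra generated by the modes at the switching instants \<open>0, \<dots>, j - 1\<close>.\<close>

definition (in prob_space) mode_history ::
  "(real \<Rightarrow> 'a \<Rightarrow> nat) \<Rightarrow> (nat \<Rightarrow> 'a \<Rightarrow> real) \<Rightarrow> nat \<Rightarrow> 'a measure" where
  "mode_history \<sigma> \<tau> j =
     vimage_algebra (space M) (\<lambda>\<omega>. \<lambda>k\<in>{..<j}. mode_at \<sigma> \<tau> k \<omega>) (\<Pi>\<^sub>M k\<in>{..<j}. count_space UNIV)"

text \<open>The last conjunct is the independence of the two sequences. It is stated through the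
  \<open>\<sigma>\<close>-algebras they generate, since \<open>indep_var\<close> requires both sides to have the same value type.\<close>

definition (in prob_space) class_EH ::
  "nat \<Rightarrow> real \<Rightarrow> (nat \<Rightarrow> real) \<Rightarrow> (real \<Rightarrow> 'a \<Rightarrow> nat) \<Rightarrow> (nat \<Rightarrow> 'a \<Rightarrow> real) \<Rightarrow> bool" where
  "class_EH N rate q \<sigma> \<tau> \<longleftrightarrow>
     0 < rate \<and>
     indep_vars (\<lambda>_. borel) (holding_time \<tau>) {1..} \<and>
     (\<forall>i\<ge>1. \<forall>s\<ge>0. prob {\<omega>\<in>space M. holding_time \<tau> i \<omega> \<le> s} = 1 - exp (- rate * s)) \<and>
     (\<forall>i\<in>{1..N}. q i \<in> {0..1}) \<and>
     (\<forall>j. random_variable (count_space UNIV) (mode_at \<sigma> \<tau> j)) \<and>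
     (\<forall>j\<ge>1. \<forall>i\<in>{1..N}. AE \<omega> in M.
        real_cond_exp M (mode_history \<sigma> \<tau> j) (indicator {\<omega>'\<in>space M. mode_at \<sigma> \<tau> j \<omega>' = i}) \<omega> = q i) \<and>
     indep_set
       (sets (vimage_algebra (space M) (\<lambda>\<omega>. \<lambda>i\<in>{1..}. holding_time \<tau> i \<omega>) (\<Pi>\<^sub>M i\<in>{1..}. borel)))
       (sets (vimage_algebra (space M) (\<lambda>\<omega> j. mode_at \<sigma> \<tau> j \<omega>) (\<Pi>\<^sub>M j\<in>UNIV. count_space UNIV)))"

subsection \<open>Global asymptotic stability almost surely\<close>

text \<open>That the solution exists for all \<open>t \<ge> 0\<close> is implicit in bounding it on \<open>{0..}\<close>, hence the
  conjunct \<open>T = \<infinity>\<close>. The suprema are taken in \<open>ereal\<close>, so an unbounded solution has supremum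
  \<open>\<infinity>\<close>.\<close>

definition stable_as ::
  "'w measure \<Rightarrow> (nat \<Rightarrow> 'a::real_normed_vector \<Rightarrow> 'a) \<Rightarrow> (real \<Rightarrow> 'w \<Rightarrow> nat) \<Rightarrow> bool" where
  "stable_as M f \<sigma> \<longleftrightarrow>
     (AE \<omega> in M. \<forall>\<epsilon>>0. \<exists>\<delta>>0. \<forall>x\<^sub>0. norm x\<^sub>0 < \<delta> \<longrightarrow>
        (\<forall>T x. maximal_solution f (\<lambda>t. \<sigma> t \<omega>) x\<^sub>0 T x \<longrightarrow>
           T = \<infinity> \<and> (SUP t\<in>{0..}. ereal (norm (x t))) < ereal \<epsilon>))"

definition globally_attractive_as ::
  "'w measure \<Rightarrow> (nat \<Rightarrow> 'a::real_normed_vector \<Rightarrow> 'a) \<Rightarrow> (real \<Rightarrow> 'w \<Rightarrow> nat) \<Rightarrow> bool" where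
  "globally_attractive_as M f \<sigma> \<longleftrightarrow>
     (AE \<omega> in M. \<forall>r>0. \<forall>\<epsilon>>0. \<exists>t\<^sub>0\<ge>0. \<forall>x\<^sub>0. norm x\<^sub>0 < r \<longrightarrow>
        (\<forall>T x. maximal_solution f (\<lambda>t. \<sigma> t \<omega>) x\<^sub>0 T x \<longrightarrow>
           T = \<infinity> \<and> (SUP t\<in>{t\<^sub>0..}. ereal (norm (x t))) < ereal \<epsilon>))"

definition globally_asymptotically_stable_as ::
  "'w measure \<Rightarrow> (nat \<Rightarrow> 'a::real_normed_vector \<Rightarrow> 'a) \<Rightarrow> (real \<Rightarrow> 'w \<Rightarrow> nat) \<Rightarrow> bool" where
  "globally_asymptotically_stable_as M f \<sigma> \<longleftrightarrow> stable_as M f \<sigma> \<and> globally_attractive_as M f \<sigma>"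

end

theory Submission
  imports Defs
begin

text \<open>Write \<open>Z n = (\<Prod>k<n. \<mu> * exp (- lam (m k) * S (k + 1)))\<close>, where \<open>m k\<close> is the mode chosen at the
  \<open>k\<close>-th switching instant and \<open>S\<close> are the holding times. Along a path, the Lyapunov function of
  the active mode grows by at most the factor \<open>Z n\<close> up to the \<open>n\<close>-th switching instant, and by at
  most \<open>Z n + Z (n + 1)\<close> up to any time before the next one; hence \<open>Z n \<longlonglongrightarrow> 0\<close> gives both stability and
  attractivity. Integrating out the holding times and then the modes one by one shows that the
  expectation of \<open>Z n\<close> decays geometrically with ratio \<open>\<Sum>i. \<mu> * q i / (1 + lam i / rate) < 1\<close>, so
  \<open>\<Sum>n. Z n\<close> has finite expectation and \<open>Z n \<longlonglongrightarrow> 0\<close> almost surely.\<close>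

subsection \<open>Absolutely continuous functions\<close>

text \<open>The bound by \<open>Z n\<close> involves \<omega> but never the initial state. This is
  why one almost sure event serves all initial states at once, as the definitions demand by choosing
  \<delta> and \<open>t\<^sub>0\<close> before \<open>x\<^sub>0\<close>. Some \<open>lam i\<close>
  may be negative: such a mode may be unstable, a long holding time then costs an arbitrarily large
  factor, and only averages are under control. For an exponential time \<open>S\<close> the mean of
  \<open>exp (- lam i * S)\<close> is \<open>rate / (rate + lam i)\<close>, finite by
  \<open>E3\<close>; weighting with \<open>\<mu> * q i\<close> gives the sum in \<open>E4\<close>.
  The initial mode is not drawn from \<open>q\<close>, so its factor is kept apart as a constant.
  Two obstacles shape the analytic part. Solutions are only absolutely continuous, so decrease must
  be deduced from a derivative known almost everywhere. A maximal solution might explode, so its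
  infinite lifetime must come out of the same Lyapunov bound, by continuing bounded solutions. That
  in turn requires switching instants that do not accumulate, which the moment argument also
  supplies, with \<open>exp (- \<tau> n)\<close> in place of \<open>Z n\<close>.\<close>

lemma division_of_real_interval_bounds:
  fixes d :: "real set set"
  assumes "d division_of S" "K \<in> d"
  shows "Inf K \<le> Sup K" "Inf K \<in> S" "Sup K \<in> S"
proof -
  obtain a b where K: "K = {a..b}" and "K \<noteq> {}" "K \<subseteq> S"
    using division_ofD(2-4)[OF assms(1)] assms(2) by (metis box_real(2))
  then have "a \<le> b" by auto
  with K \<open>K \<subseteq> S\<close> show "Inf K \<le> Sup K" "Inf K \<in> S" "Sup K \<in> S" by auto
qed

text \<open>A single transfer principle replaces separate rules for sums, products and compositions:
  the auxiliary functions below are built from time and a solution, so their increments are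
  controlled by those of the two.\<close>

lemma absolutely_continuous_fun_on_dominated:
  fixes g :: "real \<Rightarrow> 'a::real_normed_vector" and h :: "real \<Rightarrow> 'b::real_normed_vector"
  assumes ac: "absolutely_continuous_fun_on I g"
    and le: "\<And>u v. u \<in> I \<Longrightarrow> v \<in> I \<Longrightarrow> u \<le> v \<Longrightarrow> norm (h v - h u) \<le> A * (v - u) + B * norm (g v - g u)"
  shows "absolutely_continuous_fun_on I h"
  unfolding absolutely_continuous_fun_on_def
proof (intro allI impI)
  fix \<epsilon> :: real assume "\<epsilon> > 0"
  \<comment> \<open>No sign is assumed for \<open>A\<close> and \<open>B\<close>; the enlarged
    constants are positive, so \<epsilon> can be split evenly between the two terms.\<close>
  define A' B' where "A' = \<bar>A\<bar> + 1" and "B' = \<bar>B\<bar> + 1"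
  have pos: "A' > 0" "B' > 0" by (auto simp: A'_def B'_def)
  then have "\<epsilon> / (2 * B') > 0" using \<open>\<epsilon> > 0\<close> by simp
  from ac this obtain \<delta> where \<delta>: "\<delta> > 0" and D: "\<forall>d. d division_of \<Union>d \<and> \<Union>d \<subseteq> I \<and> (\<Sum>K\<in>d. Sup K - Inf K) < \<delta>
      \<longrightarrow> (\<Sum>K\<in>d. norm (g (Sup K) - g (Inf K))) < \<epsilon> / (2 * B')"
    unfolding absolutely_continuous_fun_on_def by blast
  show "\<exists>\<delta>>0. \<forall>d. d division_of \<Union>d \<and> \<Union>d \<subseteq> I \<and> (\<Sum>K\<in>d. Sup K - Inf K) < \<delta> \<longrightarrow>
          (\<Sum>K\<in>d. norm (h (Sup K) - h (Inf K))) < \<epsilon>"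
  proof (intro exI[of _ "min \<delta> (\<epsilon> / (2 * A'))"] conjI allI impI)
    show "min \<delta> (\<epsilon> / (2 * A')) > 0" using \<delta> \<open>\<epsilon> > 0\<close> pos by simp
    fix d assume d: "d division_of \<Union>d \<and> \<Union>d \<subseteq> I \<and> (\<Sum>K\<in>d. Sup K - Inf K) < min \<delta> (\<epsilon> / (2 * A'))"
    have "(\<Sum>K\<in>d. norm (h (Sup K) - h (Inf K)))
        \<le> (\<Sum>K\<in>d. A' * (Sup K - Inf K) + B' * norm (g (Sup K) - g (Inf K)))"
    proof (rule sum_mono)
      fix K assume "K \<in> d"
      then have K: "Inf K \<le> Sup K" "Inf K \<in> I" "Sup K \<in> I"
        using division_of_real_interval_bounds d by blast+
      have "norm (h (Sup K) - h (Inf K)) \<le> A * (Sup K - Inf K) + B * norm (g (Sup K) - g (Inf K))"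
        using le K by blast
      also have "\<dots> \<le> A' * (Sup K - Inf K) + B' * norm (g (Sup K) - g (Inf K))"
        using K by (intro add_mono mult_right_mono) (auto simp: A'_def B'_def)
      finally show "norm (h (Sup K) - h (Inf K)) \<le> A' * (Sup K - Inf K) + B' * norm (g (Sup K) - g (Inf K))" .
    qed
    also have "\<dots> = A' * (\<Sum>K\<in>d. Sup K - Inf K) + B' * (\<Sum>K\<in>d. norm (g (Sup K) - g (Inf K)))"
      by (simp add: sum.distrib sum_distrib_left)
    also have "\<dots> < A' * (\<epsilon> / (2 * A')) + B' * (\<epsilon> / (2 * B'))"
      using d D[rule_format, of d] pos by (intro add_strict_mono mult_strict_left_mono) auto
    also have "\<dots> = \<epsilon>" using pos by simp
    finally show "(\<Sum>K\<in>d. norm (h (Sup K) - h (Inf K))) < \<epsilon>" .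
  qed
qed

lemma absolutely_continuous_fun_on_lipschitz:
  fixes h :: "real \<Rightarrow> 'b::real_normed_vector"
  assumes "\<And>u v. u \<in> I \<Longrightarrow> v \<in> I \<Longrightarrow> u \<le> v \<Longrightarrow> norm (h v - h u) \<le> L * (v - u)"
  shows "absolutely_continuous_fun_on I h"
proof (rule absolutely_continuous_fun_on_dominated[where g = "\<lambda>_. 0 :: real" and A = L and B = 0])
  show "absolutely_continuous_fun_on I (\<lambda>_. 0 :: real)"
    by (auto simp: absolutely_continuous_fun_on_def intro: exI[of _ "1::real"])
qed (use assms in auto)

lemma absolutely_continuous_fun_on_subset:
  assumes "absolutely_continuous_fun_on I g" "J \<subseteq> I"
  shows "absolutely_continuous_fun_on J g"
  using assms unfolding absolutely_continuous_fun_on_def by (meson order.trans)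

lemma absolutely_continuous_fun_on_imp_continuous_on:
  fixes g :: "real \<Rightarrow> 'a::real_normed_vector"
  assumes ac: "absolutely_continuous_fun_on {a..b} g"
  shows "continuous_on {a..b} g"
  unfolding continuous_on_iff
proof (intro ballI allI impI)
  fix x \<epsilon> :: real assume x: "x \<in> {a..b}" and "\<epsilon> > 0"
  from ac \<open>\<epsilon> > 0\<close> obtain \<delta> where \<delta>: "\<delta> > 0" and D: "\<forall>d. d division_of \<Union>d \<and> \<Union>d \<subseteq> {a..b} \<and> (\<Sum>K\<in>d. Sup K - Inf K) < \<delta>
      \<longrightarrow> (\<Sum>K\<in>d. norm (g (Sup K) - g (Inf K))) < \<epsilon>"
    unfolding absolutely_continuous_fun_on_def by blast
  \<comment> \<open>A division with a single cell reduces absolute continuity to uniform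
    continuity.\<close>
  have *: "norm (g v - g u) < \<epsilon>" if "u \<in> {a..b}" "v \<in> {a..b}" "u \<le> v" "v - u < \<delta>" for u v
    using D[rule_format, of "{cbox u v}"] that division_of_self[of u v] by auto
  show "\<exists>d>0. \<forall>x'\<in>{a..b}. dist x' x < d \<longrightarrow> dist (g x') (g x) < \<epsilon>"
  proof (intro exI conjI ballI impI)
    show "\<delta> > 0" by fact
    fix y assume "y \<in> {a..b}" "dist y x < \<delta>"
    then show "dist (g y) (g x) < \<epsilon>"
      using *[of x y] *[of y x] x by (cases "x \<le> y") (auto simp: dist_norm norm_minus_commute)
  qed
qed

text \<open>The straddle lemma: for \<open>u\<close> and \<open>v\<close> on opposite sides of
  \<open>x\<close> the two linearisation errors add up to exactly \<epsilon> times
  \<open>v - u\<close>. This is the form needed for a cell that contains its tag.\<close>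

lemma DERIV_nonpos_straddle:
  fixes g :: "real \<Rightarrow> real"
  assumes "(g has_real_derivative D) (at x)" "D \<le> 0" "\<epsilon> > 0"
  obtains r where "r > 0" "\<And>u v. u \<in> ball x r \<Longrightarrow> v \<in> ball x r \<Longrightarrow> u \<le> x \<Longrightarrow> x \<le> v \<Longrightarrow> g v - g u \<le> \<epsilon> * (v - u)"
proof -
  have "(g has_derivative (*) D) (at x)"
    using assms(1) by (simp add: has_field_derivative_def)
  then obtain r where r: "r > 0" "\<And>y. norm (y - x) < r \<Longrightarrow> norm (g y - g x - D * (y - x)) \<le> \<epsilon> * norm (y - x)"
    using \<open>\<epsilon> > 0\<close> unfolding has_derivative_at_alt by metis
  show thesis
  proof (rule that[OF r(1)])
    fix u v assume uv: "u \<in> ball x r" "v \<in> ball x r" "u \<le> x" "x \<le> v"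
    then have "g v - g x - D * (v - x) \<le> \<epsilon> * (v - x)" "- (g u - g x - D * (u - x)) \<le> \<epsilon> * (x - u)"
      using r(2)[of v] r(2)[of u] by (auto simp: dist_real_def abs_le_iff abs_minus_commute)
    moreover have "D * (v - u) \<le> 0"
      using assms(2) uv by (simp add: mult_nonpos_nonneg)
    ultimately show "g v - g u \<le> \<epsilon> * (v - u)" by (simp add: algebra_simps)
  qed
qed

text \<open>Cousin's lemma: a tagged division that is fine for a suitable gauge splits into intervals
  tagged in the exceptional null set, where absolute continuity bounds the increment, and intervals
  tagged at points with nonpositive derivative.\<close>

lemma absolutely_continuous_nonincreasing:
  fixes g :: "real \<Rightarrow> real"
  assumes ac: "absolutely_continuous_fun_on {a..b} g" and ab: "a \<le> b"
    and ae: "AE t in lborel. a < t \<and> t < b \<longrightarrow> (\<exists>D\<le>0. (g has_real_derivative D) (at t))"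
  shows "g b \<le> g a"
proof (rule field_le_epsilon)
  fix e :: real assume "e > 0"
  \<comment> \<open>The cells tagged in the null set will cost \<epsilon> and all others together
    \<epsilon> times \<open>b - a\<close>.\<close>
  define \<epsilon> where "\<epsilon> = e / (1 + (b - a))"
  have \<epsilon>: "\<epsilon> > 0" using \<open>e > 0\<close> ab by (simp add: \<epsilon>_def)
  from ae obtain E0 where E0: "E0 \<in> null_sets lborel"
      "\<And>t. a < t \<Longrightarrow> t < b \<Longrightarrow> t \<notin> E0 \<Longrightarrow> \<exists>D\<le>0. (g has_real_derivative D) (at t)"
    by (auto elim!: AE_E3)
  \<comment> \<open>The hypothesis concerns the open interval only, so the end points join the
    exceptional set.\<close>
  define E where "E = E0 \<union> {a, b}"
  have E: "E \<in> null_sets lborel"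
    unfolding E_def by (intro null_sets.Un E0 finite_imp_null_set_lborel) auto
  from ac \<epsilon> obtain \<delta> where \<delta>: "\<delta> > 0" and D: "\<forall>d. d division_of \<Union>d \<and> \<Union>d \<subseteq> {a..b} \<and> (\<Sum>K\<in>d. Sup K - Inf K) < \<delta>
      \<longrightarrow> (\<Sum>K\<in>d. norm (g (Sup K) - g (Inf K))) < \<epsilon>"
    unfolding absolutely_continuous_fun_on_def by blast
  have El: "E \<in> null_sets lebesgue"
    using E by (simp add: null_sets_completionI)
  \<comment> \<open>Cells confined to \<open>U\<close> have total length below \<delta>, which is
    what makes absolute continuity applicable to them.\<close>
  obtain U where U: "open U" "E \<subseteq> U" "U - E \<in> lmeasurable" "emeasure lebesgue (U - E) < ennreal \<delta>"
    using sets_lebesgue_outer_open[of E \<delta>] El \<delta> by blast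
  have Um: "U \<in> lmeasurable" "measure lebesgue U < \<delta>"
  proof -
    have "emeasure lebesgue U = emeasure lebesgue (U - E)"
      using emeasure_Diff_null_set[OF El, of U] U(1) by simp
    then have *: "emeasure lebesgue U < ennreal \<delta>" using U(4) by simp
    then show "U \<in> lmeasurable"
      using U(1) by (intro fmeasurableI) (auto intro: less_trans)
    then show "measure lebesgue U < \<delta>"
      using * \<delta> by (simp add: emeasure_eq_measure2 ennreal_less_iff)
  qed
  have "\<forall>t\<in>{a..b} - E. \<exists>r>0. \<forall>u v. u \<in> ball t r \<longrightarrow> v \<in> ball t r \<longrightarrow> u \<le> t \<longrightarrow> t \<le> v \<longrightarrow> g v - g u \<le> \<epsilon> * (v - u)"
  proof
    fix t assume "t \<in> {a..b} - E"
    then obtain d where "d \<le> 0" "(g has_real_derivative d) (at t)"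
      using E0(2)[of t] by (auto simp: E_def order.order_iff_strict)
    then show "\<exists>r>0. \<forall>u v. u \<in> ball t r \<longrightarrow> v \<in> ball t r \<longrightarrow> u \<le> t \<longrightarrow> t \<le> v \<longrightarrow> g v - g u \<le> \<epsilon> * (v - u)"
      using DERIV_nonpos_straddle \<epsilon> by metis
  qed
  then obtain r where r: "\<And>t. t \<in> {a..b} - E \<Longrightarrow> r t > 0"
    "\<And>t u v. t \<in> {a..b} - E \<Longrightarrow> u \<in> ball t (r t) \<Longrightarrow> v \<in> ball t (r t) \<Longrightarrow> u \<le> t \<Longrightarrow> t \<le> v \<Longrightarrow> g v - g u \<le> \<epsilon> * (v - u)"
    by metis
  define \<gamma> where "\<gamma> t = (if t \<in> E then U else if t \<in> {a..b} then ball t (r t) else UNIV)" for t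
  have "gauge \<gamma>"
    unfolding gauge_def \<gamma>_def using U r(1) by auto
  then obtain p where p: "p tagged_division_of {a..b}" and fine: "\<gamma> fine p"
    using fine_division_exists_real by blast
  define p1 where "p1 = {z \<in> p. fst z \<in> E}"
  have fin: "finite p" using p by blast
  have K: "\<exists>u v. K = {u..v} \<and> u \<le> t \<and> t \<le> v \<and> {u..v} \<subseteq> {a..b} \<and> {u..v} \<subseteq> \<gamma> t"
    if tK: "(t, K) \<in> p" for t K
  proof -
    obtain u v where "K = {u..v}" using tagged_division_ofD(4)[OF p tK] by (auto simp: cbox_interval)
    moreover have "t \<in> K" "K \<subseteq> {a..b}" using tagged_division_ofD(2,3)[OF p tK] .
    moreover have "K \<subseteq> \<gamma> t" using fine tK by (auto simp: fine_def)
    ultimately show ?thesis by auto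
  qed
  have "(\<Sum>(x,K)\<in>p1. g (Sup K) - g (Inf K)) \<le> \<epsilon>"
  proof -
    let ?d = "snd ` p1"
    have "p1 tagged_partial_division_of {a..b}"
      by (rule tagged_partial_division_subset[of p]) (use p in \<open>auto simp: p1_def tagged_division_of_def\<close>)
    then have p1: "p1 tagged_division_of \<Union>?d"
      by (rule tagged_partial_division_of_Union_self)
    then have div: "?d division_of \<Union>?d" by (rule division_of_tagged_division)
    have sub: "\<Union>?d \<subseteq> {a..b}" "\<Union>?d \<subseteq> U"
      using K by (fastforce simp: p1_def \<gamma>_def)+
    have "(\<Sum>K\<in>?d. Sup K - Inf K) = (\<Sum>K\<in>?d. measure lebesgue K)"
    proof (rule sum.cong[OF refl])
      fix K assume "K \<in> ?d"
      then obtain u v where "K = {u..v}" "u \<le> v" using K by (force simp: p1_def)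
      then show "Sup K - Inf K = measure lebesgue K" by simp
    qed
    also have "\<dots> = measure lebesgue (\<Union>?d)" by (rule content_division[OF div])
    also have "\<dots> \<le> measure lebesgue U"
      by (rule measure_mono_fmeasurable[OF sub(2) _ Um(1)]) (use lmeasurable_division[OF div] in auto)
    also have "\<dots> < \<delta>" by (rule Um)
    finally have *: "(\<Sum>K\<in>?d. norm (g (Sup K) - g (Inf K))) < \<epsilon>"
      using D div sub by blast
    \<comment> \<open>Distinct tags may share a degenerate cell, so passing from tagged cells to
      cells needs a weight that vanishes on degenerate ones. The empty cell is treated separately
      because its \<open>Sup\<close> and \<open>Inf\<close> mean nothing.\<close>
    define G where "G K = (if K = {} then 0 else norm (g (Sup K) - g (Inf K)))" for K
    have ne: "K \<noteq> {}" if "(t, K) \<in> p1" for t K using K[of t K] that by (auto simp: p1_def)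
    have "(\<Sum>(x,K)\<in>p1. g (Sup K) - g (Inf K)) \<le> (\<Sum>(x,K)\<in>p1. G K)"
      using ne by (intro sum_mono) (auto simp: G_def)
    also have "\<dots> = (\<Sum>K\<in>?d. G K)"
    proof (rule sum.over_tagged_division_lemma[OF p1])
      fix u v :: real assume "box u v = {}"
      then have "v \<le> u" by auto
      then show "G (cbox u v) = 0"
        by (cases "u = v") (auto simp: G_def)
    qed
    also have "\<dots> = (\<Sum>K\<in>?d. norm (g (Sup K) - g (Inf K)))"
      using ne by (intro sum.cong) (auto simp: G_def)
    finally show ?thesis using * by linarith
  qed
  moreover have "(\<Sum>(x,K)\<in>p - p1. g (Sup K) - g (Inf K)) \<le> \<epsilon> * (b - a)"
  proof -
    have "(\<Sum>(x,K)\<in>p - p1. g (Sup K) - g (Inf K)) \<le> (\<Sum>(x,K)\<in>p - p1. \<epsilon> * (Sup K - Inf K))"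
    proof (rule sum_mono, clarify)
      fix t K assume tK: "(t, K) \<in> p" "(t, K) \<notin> p1"
      then obtain u v where uv: "K = {u..v}" "u \<le> t" "t \<le> v" "{u..v} \<subseteq> {a..b}" "{u..v} \<subseteq> \<gamma> t" using K by blast
      then have t: "t \<in> {a..b} - E" using tK by (auto simp: p1_def)
      then have "u \<in> ball t (r t)" "v \<in> ball t (r t)"
        using uv by (auto simp: \<gamma>_def subset_iff)
      then show "g (Sup K) - g (Inf K) \<le> \<epsilon> * (Sup K - Inf K)" using r(2)[OF t] uv by simp
    qed
    also have "\<dots> \<le> (\<Sum>(x,K)\<in>p. \<epsilon> * (Sup K - Inf K))"
      using K \<epsilon> by (intro sum_mono2[OF fin]) fastforce+
    also have "\<dots> = \<epsilon> * (\<Sum>(x,K)\<in>p. Sup K - Inf K)"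
      by (simp add: sum_distrib_left case_prod_beta)
    also have "\<dots> = \<epsilon> * (b - a)"
      using additive_tagged_division_1[OF ab p, of "\<lambda>x. x"] by simp
    finally show ?thesis .
  qed
  moreover have "(\<Sum>(x,K)\<in>p. g (Sup K) - g (Inf K))
      = (\<Sum>(x,K)\<in>p - p1. g (Sup K) - g (Inf K)) + (\<Sum>(x,K)\<in>p1. g (Sup K) - g (Inf K))"
    by (rule sum.subset_diff[OF _ fin]) (auto simp: p1_def)
  moreover have "(\<Sum>(x,K)\<in>p. g (Sup K) - g (Inf K)) = g b - g a"
    by (rule additive_tagged_division_1[OF ab p])
  moreover have "\<epsilon> + \<epsilon> * (b - a) = e"
  proof -
    have "\<epsilon> * (1 + (b - a)) = e" using ab by (simp add: \<epsilon>_def)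
    then show ?thesis by (simp add: algebra_simps)
  qed
  ultimately show "g b \<le> g a + e" by linarith
qed

text \<open>Projecting onto the direction \<open>w\<close> of the total increment reduces the mean
  value inequality to the scalar monotonicity result, applied to
  \<open>w \<bullet> x t - L * t\<close>. If the increment is zero then so is \<open>w\<close>,
  hence only \<open>norm w \<le> 1\<close> is used.\<close>

lemma absolutely_continuous_norm_increment_le:
  fixes x :: "real \<Rightarrow> 'a::real_inner"
  assumes ac: "absolutely_continuous_fun_on {a..b} x" and ab: "a \<le> b"
    and ae: "AE t in lborel. a < t \<and> t < b \<longrightarrow> (\<exists>D. norm D \<le> L \<and> (x has_vector_derivative D) (at t))"
  shows "norm (x b - x a) \<le> L * (b - a)"
proof -
  define w where "w = sgn (x b - x a)"
  have w: "norm w \<le> 1" by (simp add: w_def norm_sgn)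
  define h where "h t = w \<bullet> x t - L * t" for t
  have "h b \<le> h a"
  proof (rule absolutely_continuous_nonincreasing[OF _ ab])
    show "absolutely_continuous_fun_on {a..b} h"
    proof (rule absolutely_continuous_fun_on_dominated[OF ac, where A = "\<bar>L\<bar>" and B = 1])
      fix u v :: real assume "u \<le> v"
      have "norm (h v - h u) = \<bar>w \<bullet> (x v - x u) - L * (v - u)\<bar>"
        by (simp add: h_def algebra_simps)
      also have "\<dots> \<le> \<bar>w \<bullet> (x v - x u)\<bar> + \<bar>L * (v - u)\<bar>" by (rule abs_triangle_ineq4)
      also have "\<dots> \<le> 1 * norm (x v - x u) + \<bar>L\<bar> * (v - u)"
        using \<open>u \<le> v\<close> by (intro add_mono order_trans[OF Cauchy_Schwarz_ineq2] mult_right_mono w) (auto simp: abs_mult)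
      finally show "norm (h v - h u) \<le> \<bar>L\<bar> * (v - u) + 1 * norm (x v - x u)" by simp
    qed
    show "AE t in lborel. a < t \<and> t < b \<longrightarrow> (\<exists>D\<le>0. (h has_real_derivative D) (at t))"
      using ae
    proof eventually_elim
      case (elim t)
      show ?case
      proof
        assume "a < t \<and> t < b"
        then obtain D where D: "norm D \<le> L" "(x has_vector_derivative D) (at t)" using elim by blast
        have "(h has_real_derivative (w \<bullet> D - L)) (at t)"
          unfolding h_def has_real_derivative_iff_has_vector_derivative
          by (auto intro!: derivative_eq_intros D(2) bounded_linear.has_vector_derivative[OF bounded_linear_inner_right])
        moreover have "w \<bullet> D - L \<le> 0"
          using Cauchy_Schwarz_ineq2[of w D] mult_mono[OF w D(1)] by auto
        ultimately show "\<exists>D\<le>0. (h has_real_derivative D) (at t)" by blast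
      qed
    qed
  qed
  moreover have "w \<bullet> (x b - x a) = norm (x b - x a)"
    by (cases "x b = x a") (simp_all add: w_def sgn_div_norm dot_square_norm power2_eq_square)
  ultimately show ?thesis by (simp add: h_def algebra_simps)
qed

section \<open>Lyapunov functions along absolutely continuous solutions\<close>

text \<open>The gradient is bounded on a compact ball, and convexity turns this into a Lipschitz
  bound. A solution on a compact time interval stays in such a ball, so \<open>V\<close> composed
  with it inherits absolute continuity.\<close>

lemma continuous_gradient_lipschitz_on_cball:
  fixes V :: "'a::euclidean_space \<Rightarrow> real"
  assumes "has_continuous_gradient V g"
  obtains B where "\<And>y z. y \<in> cball 0 R \<Longrightarrow> z \<in> cball 0 R \<Longrightarrow> norm (V y - V z) \<le> B * norm (y - z)"
proof -
  have "compact (g ` cball 0 R)"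
    using assms unfolding has_continuous_gradient_def
    by (intro compact_continuous_image) (auto intro: continuous_on_subset)
  then obtain B where B: "\<And>y. y \<in> cball 0 R \<Longrightarrow> norm (g y) \<le> B"
    using compact_imp_bounded bounded_iff by (metis imageI)
  show thesis
  proof (rule that)
    fix y z :: 'a assume "y \<in> cball 0 R" "z \<in> cball 0 R"
    then show "norm (V y - V z) \<le> B * norm (y - z)"
    proof (intro differentiable_bound[of "cball 0 R" V "\<lambda>x h. h \<bullet> g x"])
      fix x :: 'a assume "x \<in> cball 0 R"
      show "(V has_derivative (\<lambda>h. h \<bullet> g x)) (at x within cball 0 R)"
        using assms unfolding has_continuous_gradient_def gderiv_def by (blast intro: has_derivative_at_withinI)
      show "onorm (\<lambda>h. h \<bullet> g x) \<le> B"
      proof (rule onorm_le)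
        fix h
        have "norm (h \<bullet> g x) \<le> norm h * norm (g x)" by (simp add: Cauchy_Schwarz_ineq2)
        also have "\<dots> \<le> norm h * B" using B \<open>x \<in> cball 0 R\<close> by (intro mult_left_mono) auto
        finally show "norm (h \<bullet> g x) \<le> B * norm h" by (simp add: mult.commute)
      qed
    qed auto
  qed
qed

text \<open>The integrating factor \<open>exp (c * t)\<close> turns the differential inequality into
  monotonicity of \<open>exp (c * t) * V (x t)\<close>, whatever the sign of
  \<open>c\<close>.\<close>

lemma exponential_decay_along_solution:
  fixes x :: "real \<Rightarrow> 'a::euclidean_space"
  assumes ac: "absolutely_continuous_fun_on {a..b} x" and ab: "a \<le> b"
    and ae: "AE t in lborel. a < t \<and> t < b \<longrightarrow> (x has_vector_derivative F (x t)) (at t)"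
    and grad: "has_continuous_gradient V g"
    and decay: "\<And>y. g y \<bullet> F y \<le> - c * V y"
  shows "V (x b) \<le> V (x a) * exp (- c * (b - a))"
proof -
  define h where "h t = exp (c * t) * V (x t)" for t
  have "continuous_on {a..b} x" by (rule absolutely_continuous_fun_on_imp_continuous_on[OF ac])
  then obtain R where R: "\<And>t. t \<in> {a..b} \<Longrightarrow> x t \<in> cball 0 R"
    using compact_imp_bounded[OF compact_continuous_image[OF _ compact_Icc], of a b x]
    by (force simp: bounded_iff)
  obtain B where B: "\<And>y z. y \<in> cball 0 R \<Longrightarrow> z \<in> cball 0 R \<Longrightarrow> norm (V y - V z) \<le> B * norm (y - z)"
    using continuous_gradient_lipschitz_on_cball[OF grad] by metis
  have "\<exists>B\<ge>0. \<forall>t\<in>{a..b}. norm (exp (c * t)) \<le> B"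
  proof -
    have "compact ((\<lambda>t. exp (c * t)) ` {a..b})"
      by (intro compact_continuous_image) (auto intro!: continuous_intros)
    then obtain B where "B > 0" "\<forall>y\<in>(\<lambda>t. exp (c * t)) ` {a..b}. norm y \<le> B"
      using compact_imp_bounded bounded_pos by blast
    then show ?thesis by (intro exI[of _ B]) auto
  qed
  then obtain C where C: "C \<ge> 0" "\<And>t. t \<in> {a..b} \<Longrightarrow> norm (exp (c * t)) \<le> C" by blast
  have expL: "norm (exp (c * v) - exp (c * u)) \<le> \<bar>c\<bar> * C * norm (v - u)" if "u \<in> {a..b}" "v \<in> {a..b}" for u v
  proof (rule field_differentiable_bound[OF convex_closed_interval[of a b] _ _ that(2,1)])
    fix t assume "t \<in> {a..b}"
    show "((\<lambda>t. exp (c * t)) has_real_derivative c * exp (c * t)) (at t within {a..b})"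
      by (auto intro!: derivative_eq_intros)
    show "norm (c * exp (c * t)) \<le> \<bar>c\<bar> * C"
      using C(2)[OF \<open>t \<in> {a..b}\<close>] by (auto simp: abs_mult intro!: mult_left_mono)
  qed
  have VM: "norm (V (x t)) \<le> \<bar>V (x a)\<bar> + \<bar>B\<bar> * (2 * R)" if "t \<in> {a..b}" for t
  proof -
    have "norm (V (x t) - V (x a)) \<le> B * norm (x t - x a)" using B R that ab by auto
    also have "\<dots> \<le> \<bar>B\<bar> * norm (x t - x a)" by (intro mult_right_mono) auto
    also have "\<dots> \<le> \<bar>B\<bar> * (2 * R)"
    proof (rule mult_left_mono)
      show "norm (x t - x a) \<le> 2 * R"
        using R[OF that] R[of a] ab norm_triangle_ineq4[of "x t" "x a"] by auto
    qed auto
    finally show ?thesis by auto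
  qed
  have "h b \<le> h a"
  proof (rule absolutely_continuous_nonincreasing[OF _ ab])
    define M where "M = \<bar>V (x a)\<bar> + \<bar>B\<bar> * (2 * R)"
    show "absolutely_continuous_fun_on {a..b} h"
    proof (rule absolutely_continuous_fun_on_dominated[OF ac, where A = "\<bar>c\<bar> * C * M" and B = "C * \<bar>B\<bar>"])
      fix u v :: real assume uv: "u \<in> {a..b}" "v \<in> {a..b}" "u \<le> v"
      \<comment> \<open>Product rule for increments: each increment is multiplied by a bound for the
        other factor, \<open>M\<close> for \<open>V\<close> along the path and \<open>C\<close> for
        the exponential.\<close>
      have "h v - h u = (exp (c * v) - exp (c * u)) * V (x v) + exp (c * u) * (V (x v) - V (x u))"
        by (simp add: h_def algebra_simps)
      then have "norm (h v - h u) \<le> norm (exp (c * v) - exp (c * u)) * norm (V (x v)) + norm (exp (c * u)) * norm (V (x v) - V (x u))"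
        by (metis norm_mult norm_triangle_ineq)
      also have "\<dots> \<le> (\<bar>c\<bar> * C * norm (v - u)) * M + C * (\<bar>B\<bar> * norm (x v - x u))"
      proof (intro add_mono mult_mono)
        show "norm (V (x v) - V (x u)) \<le> \<bar>B\<bar> * norm (x v - x u)"
          using B[OF R[OF uv(2)] R[OF uv(1)]] by (rule order_trans) (intro mult_right_mono, auto)
        show "norm (exp (c * v) - exp (c * u)) \<le> \<bar>c\<bar> * C * norm (v - u)" by (rule expL[OF uv(1,2)])
        show "norm (V (x v)) \<le> M" unfolding M_def by (rule VM[OF uv(2)])
        show "norm (exp (c * u)) \<le> C" by (rule C(2)[OF uv(1)])
      qed (use C(1) in auto)
      finally show "norm (h v - h u) \<le> \<bar>c\<bar> * C * M * (v - u) + C * \<bar>B\<bar> * norm (x v - x u)"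
        using uv by (simp add: mult_ac)
    qed
    show "AE t in lborel. a < t \<and> t < b \<longrightarrow> (\<exists>D\<le>0. (h has_real_derivative D) (at t))"
      using ae
    proof eventually_elim
      case (elim t)
      show ?case
      proof
        assume "a < t \<and> t < b"
        then have x': "(x has_vector_derivative F (x t)) (at t)" using elim by blast
        have "(V has_derivative (\<lambda>h. h \<bullet> g (x t))) (at (x t))"
          using grad by (simp add: has_continuous_gradient_def gderiv_def)
        from has_derivative_compose[OF x'[unfolded has_vector_derivative_def] this]
        have "((\<lambda>t. V (x t)) has_real_derivative (F (x t) \<bullet> g (x t))) (at t)"
          by (simp add: has_field_derivative_def o_def mult.commute[of _ "F (x t) \<bullet> g (x t)"])
        then have "(h has_real_derivative (exp (c * t) * (c * V (x t) + g (x t) \<bullet> F (x t)))) (at t)"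
          unfolding h_def by (auto intro!: derivative_eq_intros simp: algebra_simps inner_commute)
        moreover have "exp (c * t) * (c * V (x t) + g (x t) \<bullet> F (x t)) \<le> 0"
          using decay[of "x t"] by (intro mult_nonneg_nonpos) auto
        ultimately show "\<exists>D\<le>0. (h has_real_derivative D) (at t)" by blast
      qed
    qed
  qed
  then have "exp (- (c * b)) * h b \<le> exp (- (c * b)) * h a"
    by (intro mult_left_mono) auto
  also have "exp (- (c * b)) * h b = V (x b)"
    by (simp add: h_def flip: mult.assoc exp_add)
  also have "exp (- (c * b)) * h a = V (x a) * exp (- c * (b - a))"
    by (simp add: h_def algebra_simps flip: mult.assoc exp_add)
  finally show ?thesis .
qed

subsection \<open>Existence and extension of solutions\<close>

text \<open>Picard iteration. Clamping the time makes the iterates bounded continuous functions on the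
  whole line.\<close>

lemma lipschitz_initial_value_problem:
  fixes F :: "'a::euclidean_space \<Rightarrow> 'a"
  assumes F: "L-lipschitz_on (ball p u) F" and u: "u > 0" and h0: "h0 > 0"
  obtains h z B where "0 < h" "h \<le> h0" "z a = p" "B-lipschitz_on {a..a + h} z"
    "\<And>t. t \<in> {a..a + h} \<Longrightarrow> (z has_vector_derivative F (z t)) (at t within {a..a + h})"
proof -
  have L: "L \<ge> 0" by (rule lipschitz_on_nonneg[OF F])
  \<comment> \<open>Halving the radius leaves a closed ball inside the region where \<open>F\<close>
    is Lipschitz; closedness is needed for completeness of the space of iterates.\<close>
  define r where "r = u / 2"
  have r: "r > 0" "cball p r \<subseteq> ball p u" using u by (auto simp: r_def)
  define B where "B = norm (F p) + L * r"
  have B: "norm (F q) \<le> B" if "q \<in> cball p r" for q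
  proof -
    have "dist (F q) (F p) \<le> L * dist q p"
      using lipschitz_onD[OF F] that r u by (auto simp: subset_iff)
    also have "\<dots> \<le> L * r" using that L by (intro mult_left_mono) (auto simp: dist_commute)
    finally show ?thesis
      using norm_triangle_sub[of "F q" "F p"] by (auto simp: B_def dist_norm)
  qed
  have B0: "B \<ge> 0" using B[of p] r by (meson centre_in_cball less_imp_le norm_ge_zero order_trans)
  \<comment> \<open>The bound with \<open>r\<close> keeps the iterates in the ball, the one with
    \<open>L\<close> makes the integral operator a contraction with factor 1/2. Adding 1 avoids
    division by zero.\<close>
  define h where "h = min h0 (min (r / (B + 1)) (1 / (2 * (L + 1))))"
  have h: "h > 0" "h \<le> h0" using h0 r L B0 by (auto simp: h_def)
  have hB: "B * h \<le> r"
  proof -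
    have "B * h \<le> (B + 1) * (r / (B + 1))" using B0 r h by (intro mult_mono) (auto simp: h_def)
    then show ?thesis using B0 by simp
  qed
  have hL: "L * h \<le> 1 / 2"
  proof -
    have "L * h \<le> (L + 1) * (1 / (2 * (L + 1)))" using L h by (intro mult_mono) (auto simp: h_def)
    also have "\<dots> = 1 / 2" using L by (simp add: field_simps)
    finally show ?thesis .
  qed
  define clamp where "clamp t = max a (min t (a + h))" for t
  have clamp: "clamp t \<in> {a..a + h}" for t using h by (auto simp: clamp_def)
  define S :: "(real \<Rightarrow>\<^sub>C 'a) set" where "S = PiC UNIV (\<lambda>_. cball p r)"
  define I where "I \<phi> t = p + integral {a..t} (\<lambda>s. F (apply_bcontfun \<phi> s))" for \<phi> t
  define \<Phi> where "\<Phi> \<phi> = Bcontfun (\<lambda>t. I \<phi> (clamp t))" for \<phi>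
  have S_iff: "\<phi> \<in> S \<longleftrightarrow> (\<forall>t. apply_bcontfun \<phi> t \<in> cball p r)" for \<phi>
    unfolding S_def mem_PiC_iff by blast
  have S: "apply_bcontfun \<phi> t \<in> cball p r" if "\<phi> \<in> S" for \<phi> t
    using that S_iff by blast
  have cont: "continuous_on T (\<lambda>s. F (apply_bcontfun \<phi> s))" if "\<phi> \<in> S" for \<phi> T
  proof (rule continuous_on_compose2[OF lipschitz_on_continuous_on[OF F] continuous_on_apply_bcontfun])
    show "apply_bcontfun \<phi> ` T \<subseteq> ball p u" using S[OF that] r(2) by blast
  qed
  have I_dist: "dist p (I \<phi> t) \<le> r" if "\<phi> \<in> S" "t \<in> {a..a + h}" for \<phi> t
  proof -
    have "norm (integral {a..t} (\<lambda>s. F (apply_bcontfun \<phi> s))) \<le> B * (t - a)"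
      using that S B cont by (intro integral_bound) auto
    also have "\<dots> \<le> B * h" using that B0 by (intro mult_left_mono) auto
    finally show ?thesis using hB by (simp add: I_def dist_norm)
  qed
  have I_cont: "continuous_on {a..a + h} (I \<phi>)" if "\<phi> \<in> S" for \<phi>
    unfolding I_def
    by (intro continuous_intros indefinite_integral_continuous_1 integrable_continuous_interval cont that)
  have \<Phi>_apply: "apply_bcontfun (\<Phi> \<phi>) t = I \<phi> (clamp t)" if "\<phi> \<in> S" for \<phi> t
  proof -
    have "continuous_on UNIV (\<lambda>t. I \<phi> (clamp t))"
      by (rule continuous_on_compose2[OF I_cont[OF that]])
        (use clamp in \<open>auto simp: clamp_def intro!: continuous_intros\<close>)
    moreover have "bounded (range (\<lambda>t. I \<phi> (clamp t)))"
      unfolding bounded_def using I_dist[OF that clamp] by blast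
    ultimately have "(\<lambda>t. I \<phi> (clamp t)) \<in> bcontfun" by (simp add: bcontfun_def)
    then show ?thesis by (simp add: \<Phi>_def Bcontfun_inverse)
  qed
  have closed: "closed S"
    unfolding S_def by (rule closed_PiC) auto
  have "\<exists>!\<phi>\<in>S. \<Phi> \<phi> = \<phi>"
  proof (rule Banach_fix[where c = "1/2"])
    have "const_bcontfun p \<in> S"
      using r by (simp add: S_iff const_bcontfun.rep_eq)
    then show "S \<noteq> {}" by blast
    show "\<Phi> ` S \<subseteq> S"
    proof
      fix \<psi> assume "\<psi> \<in> \<Phi> ` S"
      then obtain \<phi> where "\<phi> \<in> S" "\<psi> = \<Phi> \<phi>" by blast
      then show "\<psi> \<in> S"
        using I_dist[OF \<open>\<phi> \<in> S\<close> clamp] unfolding S_iff[of \<psi>] by (simp add: \<Phi>_apply)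
    qed
    fix \<phi> \<psi> assume \<phi>\<psi>: "\<phi> \<in> S" "\<psi> \<in> S"
    show "dist (\<Phi> \<phi>) (\<Phi> \<psi>) \<le> 1/2 * dist \<phi> \<psi>"
    proof (rule dist_bound)
      fix t
      let ?t = "clamp t"
      have "dist (\<Phi> \<phi> t) (\<Phi> \<psi> t) = norm (integral {a..?t} (\<lambda>s. F (\<phi> s) - F (\<psi> s)))"
        by (simp add: \<Phi>_apply \<phi>\<psi> I_def dist_norm integral_diff integrable_continuous_interval cont)
      also have "\<dots> \<le> (L * dist \<phi> \<psi>) * (?t - a)"
      proof (rule integral_bound)
        show "continuous_on {a..?t} (\<lambda>s. F (\<phi> s) - F (\<psi> s))"
          by (intro continuous_intros cont \<phi>\<psi>)
        fix s
        have "\<phi> s \<in> ball p u" "\<psi> s \<in> ball p u" using S \<phi>\<psi> r(2) by blast+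
        then have "dist (F (\<phi> s)) (F (\<psi> s)) \<le> L * dist (\<phi> s) (\<psi> s)" by (rule lipschitz_onD[OF F])
        also have "\<dots> \<le> L * dist \<phi> \<psi>" by (intro mult_left_mono dist_bounded L)
        finally show "norm (F (\<phi> s) - F (\<psi> s)) \<le> L * dist \<phi> \<psi>" by (simp add: dist_norm)
      qed (use clamp[of t] in auto)
      also have "\<dots> \<le> (L * dist \<phi> \<psi>) * h" using clamp[of t] L by (intro mult_left_mono) auto
      also have "\<dots> = (L * h) * dist \<phi> \<psi>" by simp
      also have "\<dots> \<le> 1 / 2 * dist \<phi> \<psi>" by (intro mult_right_mono hL) auto
      finally show "dist (\<Phi> \<phi> t) (\<Phi> \<psi> t) \<le> 1/2 * dist \<phi> \<psi>" .
    qed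
  qed (use closed in \<open>auto simp: complete_eq_closed\<close>)
  then obtain \<phi> where \<phi>: "\<phi> \<in> S" "\<Phi> \<phi> = \<phi>" by blast
  have z: "apply_bcontfun \<phi> t = I \<phi> t" if "t \<in> {a..a + h}" for t
    using \<Phi>_apply[OF \<phi>(1), of t] \<phi>(2) that by (simp add: clamp_def)
  have der: "(apply_bcontfun \<phi> has_vector_derivative F (\<phi> t)) (at t within {a..a + h})"
    if t: "t \<in> {a..a + h}" for t
  proof (rule has_vector_derivative_transform[OF t z])
    show "(I \<phi> has_vector_derivative F (\<phi> t)) (at t within {a..a + h})"
      unfolding I_def using has_vector_derivative_add_const
      by (auto intro!: derivative_eq_intros integral_has_vector_derivative cont[OF \<phi>(1)] t)
  qed
  show thesis
  proof (rule that[of h "apply_bcontfun \<phi>" B])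
    show "apply_bcontfun \<phi> a = p" using z[of a] h by (simp add: I_def)
    show "B-lipschitz_on {a..a + h} (apply_bcontfun \<phi>)"
    proof (rule bounded_derivative_imp_lipschitz[OF der[unfolded has_vector_derivative_def]])
      fix t
      show "onorm (\<lambda>x. x *\<^sub>R F (\<phi> t)) \<le> B"
        by (rule onorm_le) (use B[OF S[OF \<phi>(1)], of t] in \<open>simp add: mult.commute[of B] mult_left_mono\<close>)
    qed (use B0 in auto)
  qed (use h der in auto)
qed

section \<open>Continuing bounded Caratheodory solutions\<close>

lemma caratheodory_solution_subinterval:
  assumes sol: "caratheodory_solution f s x\<^sub>0 T x" and "0 \<le> a" "ereal b < T" "a \<le> b"
  shows "absolutely_continuous_fun_on {a..b} x"
    and "AE t in lborel. a < t \<and> t < b \<longrightarrow> (x has_vector_derivative f (s t) (x t)) (at t)"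
proof -
  have "absolutely_continuous_fun_on {0..b} x"
    using assms unfolding caratheodory_solution_def by auto
  then show "absolutely_continuous_fun_on {a..b} x"
    by (rule absolutely_continuous_fun_on_subset) (use \<open>0 \<le> a\<close> in auto)
  have "AE t in lborel. 0 \<le> t \<and> ereal t < T \<longrightarrow> (x has_vector_derivative f (s t) (x t)) (at t)"
    using sol unfolding caratheodory_solution_def by blast
  then show "AE t in lborel. a < t \<and> t < b \<longrightarrow> (x has_vector_derivative f (s t) (x t)) (at t)"
  proof eventually_elim
    case (elim t)
    have "ereal t < T" if "t < b" using that \<open>ereal b < T\<close> by (meson ereal_less_eq(3) le_less_trans less_imp_le)
    then show ?case using elim \<open>0 \<le> a\<close> by auto
  qed
qed

lemma locally_lipschitz_imp_continuous_on:
  assumes "locally_lipschitz g"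
  shows "continuous_on A g"
proof (rule continuous_at_imp_continuous_on, rule ballI)
  fix x
  obtain u L where "u > 0" "L-lipschitz_on (ball x u) g"
    using assms unfolding locally_lipschitz_def by blast
  then show "continuous (at x) g"
    using lipschitz_on_continuous_on continuous_on_eq_continuous_at
    by (metis centre_in_ball open_ball)
qed

text \<open>On a bounded set finitely many continuous fields have bounded speed, so the solution is
  Lipschitz and has a limit at \<open>T\<close>. From there the field of the mode \<open>k\<close>,
  active immediately after \<open>T\<close>, can be solved and glued on. \<open>T\<close> itself may
  be a switching instant.\<close>

lemma bounded_caratheodory_solution_extends:
  fixes f :: "nat \<Rightarrow> 'a::euclidean_space \<Rightarrow> 'a"
  assumes sol: "caratheodory_solution f s x\<^sub>0 (ereal T) x" and T: "T > 0"
    and bnd: "\<And>t. 0 \<le> t \<Longrightarrow> t < T \<Longrightarrow> norm (x t) \<le> R"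
    and fin: "finite J" and s: "\<And>t. t \<ge> 0 \<Longrightarrow> s t \<in> J"
    and lip: "\<And>j. j \<in> J \<Longrightarrow> locally_lipschitz (f j)"
    and k: "k \<in> J" "h0 > 0" "\<And>t. T < t \<Longrightarrow> t < T + h0 \<Longrightarrow> s t = k"
  obtains T' y where "ereal T < T'" "caratheodory_solution f s x\<^sub>0 T' y"
    "\<And>t. 0 \<le> t \<Longrightarrow> t < T \<Longrightarrow> y t = x t"
proof -
  have "bounded (f j ` cball 0 R)" if "j \<in> J" for j
    by (intro compact_imp_bounded compact_continuous_image locally_lipschitz_imp_continuous_on lip that compact_cball)
  then have "bounded (\<Union>j\<in>J. f j ` cball 0 R)" using fin by blast
  then obtain L where "L > 0" and L: "\<And>j q. j \<in> J \<Longrightarrow> q \<in> cball 0 R \<Longrightarrow> norm (f j q) \<le> L"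
    unfolding bounded_pos by blast
  have xLip: "L-lipschitz_on {0..<T} x"
  proof (rule lipschitz_on_leI)
    fix u v assume uv: "u \<in> {0..<T}" "v \<in> {0..<T}" "u \<le> v"
    then have u: "0 \<le> u" and v: "ereal v < ereal T" by auto
    note sub = caratheodory_solution_subinterval[OF sol, of u v]
    have "norm (x v - x u) \<le> L * (v - u)"
    proof (rule absolutely_continuous_norm_increment_le)
      show "AE t in lborel. u < t \<and> t < v \<longrightarrow> (\<exists>D. norm D \<le> L \<and> (x has_vector_derivative D) (at t))"
        using sub(2)[OF u v uv(3)]
      proof eventually_elim
        case (elim t)
        then show ?case using uv L[OF s, of t "x t"] bnd[of t] by auto
      qed
    qed (use sub(1)[OF u v uv(3)] uv in auto)
    then show "dist (x u) (x v) \<le> L * dist u v" using uv by (simp add: dist_norm norm_minus_commute)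
  qed (use \<open>L > 0\<close> in auto)
  \<comment> \<open>A solution on a half-open interval says nothing about \<open>x T\<close>; the
    Lipschitz extension supplies the limit as the new initial value.\<close>
  obtain g where g: "L-lipschitz_on (closure {0..<T}) g" "\<forall>t\<in>{0..<T}. g t = x t"
    using lipschitz_extend_closure[OF xLip] by blast
  have gl: "L-lipschitz_on {0..T} g" using g(1) T by simp
  obtain u C where "u > 0" "C-lipschitz_on (ball (g T) u) (f k)"
    using lip[OF k(1)] unfolding locally_lipschitz_def by blast
  then obtain h z B where z: "0 < h" "h \<le> h0" "z T = g T" "B-lipschitz_on {T..T + h} z"
    "\<And>t. t \<in> {T..T + h} \<Longrightarrow> (z has_vector_derivative f k (z t)) (at t within {T..T + h})"
    using lipschitz_initial_value_problem[of C "g T" u "f k" h0 T] k(2) by metis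
  define y where "y t = (if t \<le> T then g t else z t)" for t
  \<comment> \<open>The pieces agree at \<open>T\<close>, so the glued function is Lipschitz, hence
    absolutely continuous, across the junction.\<close>
  have yl: "(max L B)-lipschitz_on {0..T + h} y"
    unfolding y_def by (rule lipschitz_on_concat_max) (use gl z in auto)
  have yx: "y t = x t" if "0 \<le> t" "t < T" for t using g(2) that by (simp add: y_def)
  show thesis
  proof (rule that[of "ereal (T + h)" y])
    show "caratheodory_solution f s x\<^sub>0 (ereal (T + h)) y"
      unfolding caratheodory_solution_def
    proof (intro conjI allI impI)
      show "y 0 = x\<^sub>0" using yx[of 0] T sol by (simp add: caratheodory_solution_def)
      fix b assume "0 \<le> b" "ereal b < ereal (T + h)"
      show "absolutely_continuous_fun_on {0..b} y"
      proof (rule absolutely_continuous_fun_on_lipschitz[where L = "max L B"])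
        fix u v assume "u \<in> {0..b}" "v \<in> {0..b}" "u \<le> v"
        then show "norm (y v - y u) \<le> max L B * (v - u)"
          using lipschitz_on_normD[OF yl, of v u] \<open>ereal b < _\<close> by auto
      qed
    next
      have "AE t in lborel. 0 \<le> t \<and> ereal t < ereal T \<longrightarrow> (x has_vector_derivative f (s t) (x t)) (at t)"
        using sol unfolding caratheodory_solution_def by blast
      \<comment> \<open>At \<open>T\<close> the one-sided slopes may differ, and at 0 the functions
        \<open>x\<close> and \<open>y\<close> are known to agree only to the right.\<close>
      moreover have "AE t in lborel. t \<notin> {0, T}"
        by (rule AE_not_in) (intro finite_imp_null_set_lborel, auto)
      ultimately show "AE t in lborel. 0 \<le> t \<and> ereal t < ereal (T + h) \<longrightarrow> (y has_vector_derivative f (s t) (y t)) (at t)"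
      proof eventually_elim
        case (elim t)
        show ?case
        proof
          assume t: "0 \<le> t \<and> ereal t < ereal (T + h)"
          show "(y has_vector_derivative f (s t) (y t)) (at t)"
          proof (cases "t < T")
            case True
            then have "0 < t" "(x has_vector_derivative f (s t) (x t)) (at t)" using elim t by auto
            then show ?thesis
              using has_vector_derivative_transform_within_open[of x _ t "{0<..<T}" y] yx True by auto
          next
            case False
            then have tT: "T < t" "t < T + h" using elim t by auto
            then have "(z has_vector_derivative f k (z t)) (at t)"
              using z(5)[of t] at_within_interior[of t "{T..T + h}"] by simp
            then have "(y has_vector_derivative f k (z t)) (at t)"
              by (rule has_vector_derivative_transform_within_open[where S = "{T<..<T + h}"])
                (use tT in \<open>auto simp: y_def\<close>)
            moreover have "s t = k" "y t = z t" using tT k(3)[of t] z(2) by (auto simp: y_def)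
            ultimately show ?thesis by simp
          qed
        qed
      qed
    qed
  qed (use z yx in auto)
qed

subsection \<open>The Lyapunov estimate along a path\<close>

text \<open>One frozen \<omega>: the assumptions collect what almost every path satisfies, so the
  analysis becomes deterministic. \<open>tau_at_top\<close> excludes accumulating switching
  instants; for the random signal it has to be derived from the law of the holding times.\<close>

locale switched_path =
  fixes f :: "nat \<Rightarrow> 'a::euclidean_space \<Rightarrow> 'a" and V :: "nat \<Rightarrow> 'a \<Rightarrow> real" and gradV :: "nat \<Rightarrow> 'a \<Rightarrow> 'a"
    and \<alpha>\<^sub>1 \<alpha>\<^sub>2 :: "real \<Rightarrow> real" and \<mu> :: real and lam :: "nat \<Rightarrow> real" and N :: nat
    and s :: "real \<Rightarrow> nat" and \<tau> :: "nat \<Rightarrow> real"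
  assumes lipschitz: "\<And>i. i \<in> {1..N} \<Longrightarrow> locally_lipschitz (f i)"
    and gradient: "\<And>i. i \<in> {1..N} \<Longrightarrow> has_continuous_gradient (V i) (gradV i)"
    and class_K: "class_K_inf \<alpha>\<^sub>1" "class_K_inf \<alpha>\<^sub>2"
    and mu: "\<mu> > 1"
    and bounds: "\<And>i x. i \<in> {1..N} \<Longrightarrow> \<alpha>\<^sub>1 (norm x) \<le> V i x \<and> V i x \<le> \<alpha>\<^sub>2 (norm x)"
    and decay: "\<And>i x. i \<in> {1..N} \<Longrightarrow> gradV i x \<bullet> f i x \<le> - lam i * V i x"
    and compare: "\<And>i j x. i \<in> {1..N} \<Longrightarrow> j \<in> {1..N} \<Longrightarrow> V i x \<le> \<mu> * V j x"
    and mode: "\<And>t. t \<ge> 0 \<Longrightarrow> s t \<in> {1..N}"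
    and tau_0: "\<tau> 0 = 0" and tau_less: "\<And>n. \<tau> n < \<tau> (Suc n)"
    and tau_at_top: "filterlim \<tau> at_top sequentially"
    and const_mode: "\<And>n t. \<tau> n \<le> t \<Longrightarrow> t < \<tau> (Suc n) \<Longrightarrow> s t = s (\<tau> n)"
begin

definition gain :: "nat \<Rightarrow> real" where
  "gain n = (\<Prod>k<n. \<mu> * exp (- lam (s (\<tau> k)) * (\<tau> (Suc k) - \<tau> k)))"

lemma gain_0 [simp]: "gain 0 = 1"
  by (simp add: gain_def)

lemma gain_Suc: "gain (Suc n) = gain n * (\<mu> * exp (- lam (s (\<tau> n)) * (\<tau> (Suc n) - \<tau> n)))"
  by (simp add: gain_def)

lemma gain_pos: "gain n > 0"
  using mu by (auto simp: gain_def intro!: prod_pos)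

lemma tau_mono: "m \<le> n \<Longrightarrow> \<tau> m \<le> \<tau> n"
  by (rule lift_Suc_mono_le[of \<tau>]) (use tau_less less_imp_le in auto)

lemma tau_nonneg: "\<tau> n \<ge> 0"
  using tau_mono[of 0 n] tau_0 by simp

lemma switching_interval:
  assumes "t \<ge> 0"
  obtains n where "\<tau> n \<le> t" "t < \<tau> (Suc n)"
proof -
  have "\<exists>n. t < \<tau> n"
    using filterlim_at_top_dense[THEN iffD1, OF tau_at_top, rule_format, of t]
    by (auto simp: eventually_sequentially)
  define n where "n = (LEAST n. t < \<tau> n)"
  have "t < \<tau> n" unfolding n_def using \<open>\<exists>n. t < \<tau> n\<close> by (rule LeastI_ex)
  moreover from this have "n \<noteq> 0" using assms tau_0 by (cases n) auto
  then obtain m where m: "n = Suc m" using not0_implies_Suc by blast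
  moreover have "\<not> t < \<tau> m" using m not_less_Least[of m "\<lambda>n. t < \<tau> n"] by (simp add: n_def)
  ultimately show thesis using that by force
qed

lemma alpha1_nonneg: "r \<ge> 0 \<Longrightarrow> \<alpha>\<^sub>1 r \<ge> 0"
  using class_K strict_mono_on_leD[of "{0..}" \<alpha>\<^sub>1 0 r] by (simp add: class_K_inf_def class_K_def)

lemma V_nonneg: "i \<in> {1..N} \<Longrightarrow> V i x \<ge> 0"
  using bounds[of i x] alpha1_nonneg[of "norm x"] by auto

context
  fixes x\<^sub>0 :: 'a and T :: ereal and x :: "real \<Rightarrow> 'a"
  assumes sol: "caratheodory_solution f s x\<^sub>0 T x"
begin

text \<open>The equation matters only inside the interval, so the next switching instant is allowed
  for \<open>t\<close>. The old mode's function can thus be evaluated there before the modes are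
  compared.\<close>

lemma V_decay:
  assumes "\<tau> n \<le> t" "t \<le> \<tau> (Suc n)" "ereal t < T"
  shows "V (s (\<tau> n)) (x t) \<le> V (s (\<tau> n)) (x (\<tau> n)) * exp (- lam (s (\<tau> n)) * (t - \<tau> n))"
proof (rule exponential_decay_along_solution[where F = "f (s (\<tau> n))"])
  note sub = caratheodory_solution_subinterval[OF sol tau_nonneg assms(3,1)]
  show "absolutely_continuous_fun_on {\<tau> n..t} x" by (rule sub)
  show "AE r in lborel. \<tau> n < r \<and> r < t \<longrightarrow> (x has_vector_derivative f (s (\<tau> n)) (x r)) (at r)"
    using sub(2)
  proof eventually_elim
    case (elim r)
    then show ?case using const_mode[of n r] assms by auto
  qed
qed (use mode tau_nonneg gradient decay assms in auto)

text \<open>Each step pays the decay over one holding time and then one factor \<mu> for changing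
  the Lyapunov function; the state itself does not jump. The factor is charged even if the mode
  stays the same.\<close>

lemma V_switching:
  assumes "ereal (\<tau> n) < T"
  shows "V (s (\<tau> n)) (x (\<tau> n)) \<le> gain n * \<alpha>\<^sub>2 (norm x\<^sub>0)"
  using assms
proof (induction n)
  case 0
  then show ?case using sol bounds[OF mode, of 0 x\<^sub>0] by (simp add: tau_0 caratheodory_solution_def)
next
  case (Suc n)
  let ?i = "s (\<tau> n)" and ?j = "s (\<tau> (Suc n))"
  have lt: "ereal (\<tau> n) < T" using Suc.prems tau_less[of n] by (meson ereal_less_eq(3) le_less_trans less_imp_le)
  have "V ?j (x (\<tau> (Suc n))) \<le> \<mu> * V ?i (x (\<tau> (Suc n)))"
    by (intro compare mode tau_nonneg)
  also have "\<dots> \<le> \<mu> * (V ?i (x (\<tau> n)) * exp (- lam ?i * (\<tau> (Suc n) - \<tau> n)))"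
    using mu Suc.prems tau_less[of n] by (intro mult_left_mono V_decay) auto
  also have "\<dots> \<le> \<mu> * ((gain n * \<alpha>\<^sub>2 (norm x\<^sub>0)) * exp (- lam ?i * (\<tau> (Suc n) - \<tau> n)))"
    using mu by (intro mult_left_mono mult_right_mono Suc.IH lt) auto
  also have "\<dots> = gain (Suc n) * \<alpha>\<^sub>2 (norm x\<^sub>0)" by (simp add: gain_Suc)
  finally show ?case .
qed

text \<open>Between switching instants the exponential is monotone in time, in a direction given by
  the sign of \<open>lam\<close>. The sum of its two end values covers both signs, and \<mu> > 1
  turns the later one into \<open>gain (Suc n)\<close>.\<close>

lemma alpha1_le:
  assumes "\<tau> n \<le> t" "t < \<tau> (Suc n)" "ereal t < T"
  shows "\<alpha>\<^sub>1 (norm (x t)) \<le> (gain n + gain (Suc n)) * \<alpha>\<^sub>2 (norm x\<^sub>0)"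
proof -
  let ?i = "s (\<tau> n)" and ?E = "\<lambda>t. exp (- lam (s (\<tau> n)) * (t - \<tau> n))"
  have i: "?i \<in> {1..N}" using mode tau_nonneg by blast
  have a2: "\<alpha>\<^sub>2 (norm x\<^sub>0) \<ge> 0" using bounds[OF i, of x\<^sub>0] V_nonneg[OF i, of x\<^sub>0] by linarith
  have "ereal (\<tau> n) < T" using assms by (meson ereal_less_eq(3) le_less_trans)
  have "?E t \<le> 1 + ?E (\<tau> (Suc n))"
  proof (cases "lam ?i \<ge> 0")
    case True
    then have "?E t \<le> 1" using assms by (simp add: mult_nonpos_nonneg)
    then show ?thesis by (smt (verit) exp_gt_zero)
  next
    case False
    then have "?E t \<le> ?E (\<tau> (Suc n))" using assms by (simp add: mult_left_mono_neg)
    then show ?thesis by linarith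
  qed
  also have "\<dots> \<le> 1 + \<mu> * ?E (\<tau> (Suc n))" using mu by simp
  finally have E: "gain n * ?E t \<le> gain n + gain (Suc n)"
    using mult_left_mono[of "?E t" "1 + \<mu> * ?E (\<tau> (Suc n))" "gain n"] gain_pos[of n]
    by (simp add: gain_Suc algebra_simps)
  have "\<alpha>\<^sub>1 (norm (x t)) \<le> V ?i (x t)" using bounds[OF i] by blast
  also have "\<dots> \<le> V ?i (x (\<tau> n)) * ?E t" by (rule V_decay) (use assms in auto)
  also have "\<dots> \<le> (gain n * \<alpha>\<^sub>2 (norm x\<^sub>0)) * ?E t" by (intro mult_right_mono V_switching) (fact, simp)
  also have "\<dots> = (gain n * ?E t) * \<alpha>\<^sub>2 (norm x\<^sub>0)" by simp
  also have "\<dots> \<le> (gain n + gain (Suc n)) * \<alpha>\<^sub>2 (norm x\<^sub>0)" by (intro mult_right_mono E a2)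
  finally show ?thesis .
qed

end

text \<open>Only finitely many gains matter before a finite time \<open>b\<close>, so the solution
  stays bounded there and can be continued, contradicting maximality.\<close>

lemma maximal_solution_global:
  assumes max: "maximal_solution f s x\<^sub>0 T x"
  shows "T = \<infinity>"
proof (rule ccontr)
  assume "T \<noteq> \<infinity>"
  with max obtain b where b: "T = ereal b" "b > 0"
    by (cases T) (auto simp: maximal_solution_def)
  have sol: "caratheodory_solution f s x\<^sub>0 (ereal b) x" using max b by (simp add: maximal_solution_def)
  obtain n where n: "\<tau> n \<le> b" "b < \<tau> (Suc n)" using switching_interval[of b] b by auto
  \<comment> \<open>The sum dominates each single gain up to \<open>Suc n\<close>. Two gains enter
    \<open>alpha1_le\<close>, whence \<open>2 * C\<close> in the choice of \<open>R\<close>.\<close>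
  define C where "C = (\<Sum>k\<le>Suc n. gain k) * \<alpha>\<^sub>2 (norm x\<^sub>0)"
  have "\<not> bdd_above (\<alpha>\<^sub>1 ` {0..})" using class_K by (simp add: class_K_inf_def)
  then obtain R where R: "R \<ge> 0" "\<alpha>\<^sub>1 R > 2 * C" unfolding bdd_above_def by (auto simp: not_le)
  have bound: "norm (x t) \<le> R" if t: "0 \<le> t" "t < b" for t
  proof -
    obtain m where m: "\<tau> m \<le> t" "t < \<tau> (Suc m)" using switching_interval t by blast
    have "m \<le> n"
    proof (rule ccontr)
      assume "\<not> m \<le> n"
      then have "\<tau> (Suc n) \<le> \<tau> m" by (intro tau_mono) simp
      then show False using m n t by linarith
    qed
    have a2: "\<alpha>\<^sub>2 (norm x\<^sub>0) \<ge> 0" using bounds[OF mode[of 0], of x\<^sub>0] V_nonneg[OF mode[of 0], of x\<^sub>0] by simp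
    have g: "gain j \<le> (\<Sum>k\<le>Suc n. gain k)" if "j \<le> Suc n" for j
      by (rule member_le_sum) (use that gain_pos less_imp_le in auto)
    have "\<alpha>\<^sub>1 (norm (x t)) \<le> (gain m + gain (Suc m)) * \<alpha>\<^sub>2 (norm x\<^sub>0)"
      by (rule alpha1_le[OF sol m]) (use t in auto)
    also have "\<dots> \<le> ((\<Sum>k\<le>Suc n. gain k) + (\<Sum>k\<le>Suc n. gain k)) * \<alpha>\<^sub>2 (norm x\<^sub>0)"
      using \<open>m \<le> n\<close> by (intro mult_right_mono add_mono g a2) auto
    also have "\<dots> = 2 * C" by (simp add: C_def)
    finally have "\<alpha>\<^sub>1 (norm (x t)) < \<alpha>\<^sub>1 R" using R by simp
    then show ?thesis
      using class_K R strict_mono_on_leD[of "{0..}" \<alpha>\<^sub>1 R "norm (x t)"]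
      by (force simp: class_K_inf_def class_K_def)
  qed
  obtain T' y where "ereal b < T'" "caratheodory_solution f s x\<^sub>0 T' y"
    "\<And>t. 0 \<le> t \<Longrightarrow> t < b \<Longrightarrow> y t = x t"
  \<comment> \<open>After \<open>b\<close> the mode stays constant until the next switching instant,
    which is strictly later.\<close>
  proof (rule bounded_caratheodory_solution_extends[OF sol b(2) bound, where J = "{1..N}" and k = "s (\<tau> n)" and ?h0.0 = "\<tau> (Suc n) - b"])
    show "s t = s (\<tau> n)" if "b < t" "t < b + (\<tau> (Suc n) - b)" for t
      using const_mode[of n t] n that by auto
  qed (use n mode lipschitz tau_nonneg in auto)
  then show False using max b unfolding maximal_solution_def by auto
qed

section \<open>Stability and attractivity along one path\<close>

lemma norm_lt_of_alpha1_le: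
  assumes "\<alpha>\<^sub>1 (norm y) \<le> c" "c < \<alpha>\<^sub>1 e" "e > 0"
  shows "norm y < e"
  using assms class_K strict_mono_on_leD[of "{0..}" \<alpha>\<^sub>1 e "norm y"]
  by (force simp: class_K_inf_def class_K_def not_less)

lemma alpha1_pos: "e > 0 \<Longrightarrow> \<alpha>\<^sub>1 e > 0"
  using class_K strict_mono_onD[of "{0..}" \<alpha>\<^sub>1 0 e] by (simp add: class_K_inf_def class_K_def)

text \<open>A convergent gain is bounded by some \<open>C\<close>, and continuity of the upper
  comparison function at 0 makes \<open>2 * C\<close> times its value small. Aiming at half of
  \<epsilon> keeps the supremum strictly below \<epsilon>.\<close>

lemma stable:
  assumes gain: "gain \<longlonglongrightarrow> 0" and "\<epsilon> > 0"
  shows "\<exists>\<delta>>0. \<forall>x\<^sub>0. norm x\<^sub>0 < \<delta> \<longrightarrow> (\<forall>T x. maximal_solution f s x\<^sub>0 T x \<longrightarrow>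
           T = \<infinity> \<and> (SUP t\<in>{0..}. ereal (norm (x t))) < ereal \<epsilon>)"
proof -
  obtain C where C: "C > 0" "\<And>n. gain n \<le> C"
    using convergent_imp_Bseq[OF convergentI[OF gain]] gain_pos unfolding Bseq_def by (auto simp: less_imp_le)
  have "continuous (at 0 within {0..}) \<alpha>\<^sub>2" "\<alpha>\<^sub>2 0 = 0"
    using class_K by (auto simp: class_K_inf_def class_K_def continuous_on_eq_continuous_within)
  moreover have "\<alpha>\<^sub>1 (\<epsilon> / 2) / (2 * C) > 0" using alpha1_pos[of "\<epsilon> / 2"] C \<open>\<epsilon> > 0\<close> by simp
  ultimately obtain \<delta> where "\<delta> > 0"
    and "\<forall>r\<in>{0..}. dist r 0 < \<delta> \<longrightarrow> dist (\<alpha>\<^sub>2 r) 0 < \<alpha>\<^sub>1 (\<epsilon> / 2) / (2 * C)"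
    unfolding continuous_within_eps_delta by metis
  then have \<delta>: "\<delta> > 0" "\<And>r. 0 \<le> r \<Longrightarrow> r < \<delta> \<Longrightarrow> \<alpha>\<^sub>2 r < \<alpha>\<^sub>1 (\<epsilon> / 2) / (2 * C)"
    by (auto simp: dist_real_def abs_less_iff)
  show ?thesis
  proof (intro exI[of _ \<delta>] conjI allI impI \<delta>(1))
    fix x\<^sub>0 T x assume x0: "norm x\<^sub>0 < \<delta>" and max: "maximal_solution f s x\<^sub>0 T x"
    show "T = \<infinity>" by (rule maximal_solution_global[OF max])
    then have sol: "caratheodory_solution f s x\<^sub>0 \<infinity> x" using max by (simp add: maximal_solution_def)
    have a2: "\<alpha>\<^sub>2 (norm x\<^sub>0) \<ge> 0" using bounds[OF mode[of 0], of x\<^sub>0] V_nonneg[OF mode[of 0], of x\<^sub>0] by simp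
    have "norm (x t) < \<epsilon> / 2" if t: "t \<ge> 0" for t
    proof -
      obtain n where n: "\<tau> n \<le> t" "t < \<tau> (Suc n)" using switching_interval[OF t] .
      have "\<alpha>\<^sub>1 (norm (x t)) \<le> (gain n + gain (Suc n)) * \<alpha>\<^sub>2 (norm x\<^sub>0)"
        by (rule alpha1_le[OF sol n]) simp
      also have "\<dots> \<le> (2 * C) * \<alpha>\<^sub>2 (norm x\<^sub>0)"
        using C(2)[of n] C(2)[of "Suc n"] by (intro mult_right_mono a2) simp
      finally have "\<alpha>\<^sub>1 (norm (x t)) \<le> (2 * C) * \<alpha>\<^sub>2 (norm x\<^sub>0)" .
      moreover have "(2 * C) * \<alpha>\<^sub>2 (norm x\<^sub>0) < \<alpha>\<^sub>1 (\<epsilon> / 2)"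
        using \<delta>(2)[OF norm_ge_zero x0] C by (simp add: field_simps)
      ultimately show ?thesis by (rule norm_lt_of_alpha1_le) (use \<open>\<epsilon> > 0\<close> in simp)
    qed
    then have "(SUP t\<in>{0..}. ereal (norm (x t))) \<le> ereal (\<epsilon> / 2)"
      by (intro SUP_least) (auto intro: less_imp_le)
    also have "\<dots> < ereal \<epsilon>" using \<open>\<epsilon> > 0\<close> by simp
    finally show "(SUP t\<in>{0..}. ereal (norm (x t))) < ereal \<epsilon>" .
  qed
qed

text \<open>The waiting time is the switching instant after which all gains are small. Monotonicity
  of the upper comparison function makes it uniform over the ball of radius
  \<open>r\<close>.\<close>

lemma attractive:
  assumes gain: "gain \<longlonglongrightarrow> 0" and "r > 0" "\<epsilon> > 0"
  shows "\<exists>t\<^sub>0\<ge>0. \<forall>x\<^sub>0. norm x\<^sub>0 < r \<longrightarrow> (\<forall>T x. maximal_solution f s x\<^sub>0 T x \<longrightarrow>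
           T = \<infinity> \<and> (SUP t\<in>{t\<^sub>0..}. ereal (norm (x t))) < ereal \<epsilon>)"
proof -
  have smono: "strict_mono_on {0..} \<alpha>\<^sub>2" "\<alpha>\<^sub>2 0 = 0" using class_K by (auto simp: class_K_inf_def class_K_def)
  then have r: "\<alpha>\<^sub>2 r > 0" using strict_mono_onD[OF smono(1), of 0 r] \<open>r > 0\<close> by simp
  then have pos: "\<alpha>\<^sub>1 (\<epsilon> / 2) / (2 * \<alpha>\<^sub>2 r) > 0" using alpha1_pos[of "\<epsilon> / 2"] \<open>\<epsilon> > 0\<close> by simp
  obtain n\<^sub>0 where n0: "\<And>n. n \<ge> n\<^sub>0 \<Longrightarrow> gain n < \<alpha>\<^sub>1 (\<epsilon> / 2) / (2 * \<alpha>\<^sub>2 r)"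
    using order_tendstoD(2)[OF gain pos] by (auto simp: eventually_sequentially)
  show ?thesis
  proof (intro exI[of _ "\<tau> n\<^sub>0"] conjI allI impI tau_nonneg)
    fix x\<^sub>0 T x assume x0: "norm x\<^sub>0 < r" and max: "maximal_solution f s x\<^sub>0 T x"
    show "T = \<infinity>" by (rule maximal_solution_global[OF max])
    then have sol: "caratheodory_solution f s x\<^sub>0 \<infinity> x" using max by (simp add: maximal_solution_def)
    have "norm (x t) < \<epsilon> / 2" if t: "t \<ge> \<tau> n\<^sub>0" for t
    proof -
      have "t \<ge> 0" using t tau_nonneg[of n\<^sub>0] by linarith
      then obtain n where n: "\<tau> n \<le> t" "t < \<tau> (Suc n)" using switching_interval by blast
      have "n\<^sub>0 \<le> n"
      proof (rule ccontr)
        assume "\<not> n\<^sub>0 \<le> n"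
        then have "\<tau> (Suc n) \<le> \<tau> n\<^sub>0" by (intro tau_mono) simp
        then show False using n t by linarith
      qed
      then have g: "gain n + gain (Suc n) < \<alpha>\<^sub>1 (\<epsilon> / 2) / \<alpha>\<^sub>2 r"
        using n0[of n] n0[of "Suc n"] by (simp add: field_simps)
      have g0: "gain n + gain (Suc n) \<ge> 0" using gain_pos[of n] gain_pos[of "Suc n"] by linarith
      have "\<alpha>\<^sub>1 (norm (x t)) \<le> (gain n + gain (Suc n)) * \<alpha>\<^sub>2 (norm x\<^sub>0)"
        by (rule alpha1_le[OF sol n]) simp
      also have "\<dots> \<le> (gain n + gain (Suc n)) * \<alpha>\<^sub>2 r"
        using strict_mono_on_leD[OF smono(1), of "norm x\<^sub>0" r] x0 \<open>r > 0\<close> by (intro mult_left_mono g0) auto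
      finally have "\<alpha>\<^sub>1 (norm (x t)) \<le> (gain n + gain (Suc n)) * \<alpha>\<^sub>2 r" .
      moreover have "(gain n + gain (Suc n)) * \<alpha>\<^sub>2 r < \<alpha>\<^sub>1 (\<epsilon> / 2)"
        using g r by (simp add: field_simps)
      ultimately show ?thesis by (rule norm_lt_of_alpha1_le) (use \<open>\<epsilon> > 0\<close> in simp)
    qed
    then have "(SUP t\<in>{\<tau> n\<^sub>0..}. ereal (norm (x t))) \<le> ereal (\<epsilon> / 2)"
      by (intro SUP_least) (auto intro: less_imp_le)
    also have "\<dots> < ereal \<epsilon>" using \<open>\<epsilon> > 0\<close> by simp
    finally show "(SUP t\<in>{\<tau> n\<^sub>0..}. ereal (norm (x t))) < ereal \<epsilon>" .
  qed
qed

end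

subsection \<open>Almost sure decay of the gain\<close>

text \<open>By monotone convergence the random series has finite expectation, so it converges almost
  surely and its terms vanish in the limit.\<close>

lemma AE_tendsto_zero_if_summable_nn_integral:
  fixes X :: "nat \<Rightarrow> 'a \<Rightarrow> real"
  assumes [measurable]: "\<And>n. X n \<in> borel_measurable M"
    and nonneg: "\<And>n \<omega>. X n \<omega> \<ge> 0"
    and fin: "(\<Sum>n. \<integral>\<^sup>+\<omega>. ennreal (X n \<omega>) \<partial>M) \<noteq> \<infinity>"
  shows "AE \<omega> in M. (\<lambda>n. X n \<omega>) \<longlonglongrightarrow> 0"
proof -
  have "(\<integral>\<^sup>+\<omega>. (\<Sum>n. ennreal (X n \<omega>)) \<partial>M) \<noteq> \<infinity>"
    using fin by (simp add: nn_integral_suminf)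
  then have "AE \<omega> in M. (\<Sum>n. ennreal (X n \<omega>)) \<noteq> \<infinity>"
    by (intro nn_integral_noteq_infinite) auto
  then show ?thesis
  proof eventually_elim
    case (elim \<omega>)
    then have "summable (\<lambda>n. X n \<omega>)" using nonneg by (intro summable_suminf_not_top) auto
    then show ?case by (rule summable_LIMSEQ_zero)
  qed
qed

text \<open>The Laplace transform by exponential tilting: the tilted density is
  \<open>r / (r + c)\<close> times the exponential density with parameter \<open>r + c\<close>,
  whose mass is 1. A negative \<open>c\<close> is allowed.\<close>

lemma nn_integral_exponential_distributed_exp:
  assumes X: "distributed M lborel X (exponential_density r)" and r: "r > 0" "r + c > 0"
  shows "(\<integral>\<^sup>+\<omega>. ennreal (exp (- c * X \<omega>)) \<partial>M) = ennreal (r / (r + c))"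
proof -
  have "(\<integral>\<^sup>+\<omega>. ennreal (exp (- c * X \<omega>)) \<partial>M) = (\<integral>\<^sup>+x. ennreal (exponential_density r x) * ennreal (exp (- c * x)) \<partial>lborel)"
    by (rule distributed_nn_integral[OF X, symmetric]) simp
  also have "\<dots> = (\<integral>\<^sup>+x. ennreal (r / (r + c)) * ennreal (exponential_density (r + c) x) \<partial>lborel)"
  proof (rule nn_integral_cong)
    fix x
    show "ennreal (exponential_density r x) * ennreal (exp (- c * x)) = ennreal (r / (r + c)) * ennreal (exponential_density (r + c) x)"
    proof (cases "x < 0")
      case False
      have "exp (- x * r) * exp (- c * x) = exp (- x * (r + c))"
        by (simp add: algebra_simps flip: exp_add)
      then have "r * exp (- x * r) * exp (- c * x) = r / (r + c) * ((r + c) * exp (- x * (r + c)))"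
        using r by simp
      then show ?thesis
        using False r by (simp add: exponential_density_def flip: ennreal_mult)
    qed (simp add: exponential_density_def)
  qed
  also have "\<dots> = ennreal (r / (r + c)) * (\<integral>\<^sup>+x. ennreal (exponential_density (r + c) x) \<partial>lborel)"
    by (rule nn_integral_cmult) simp
  also have "(\<integral>\<^sup>+x. ennreal (exponential_density (r + c) x) \<partial>lborel) = 1"
    using prob_space.emeasure_space_1[OF prob_space_exponential_density[OF r(2)]]
    by (simp add: emeasure_density)
  finally show ?thesis by simp
qed

text \<open>Independence makes the joint law a product, so Tonelli integrates out \<open>X\<close>
  with \<open>Y\<close> frozen. Here \<open>X\<close> will be the whole sequence of holding times
  and \<open>Y\<close> that of the modes.\<close>

lemma (in prob_space) nn_integral_indep_pair:
  assumes [measurable]: "random_variable S X" "random_variable T Y"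
    and indep: "indep_set {X -` A \<inter> space M | A. A \<in> sets S} {Y -` A \<inter> space M | A. A \<in> sets T}"
    and [measurable]: "h \<in> borel_measurable (S \<Otimes>\<^sub>M T)"
  shows "(\<integral>\<^sup>+\<omega>. h (X \<omega>, Y \<omega>) \<partial>M) = (\<integral>\<^sup>+\<omega>. (\<integral>\<^sup>+\<omega>'. h (X \<omega>', Y \<omega>) \<partial>M) \<partial>M)"
proof -
  interpret X: prob_space "distr M S X" by (rule prob_space_distr) simp
  interpret Y: prob_space "distr M T Y" by (rule prob_space_distr) simp
  interpret XY: pair_sigma_finite "distr M S X" "distr M T Y" ..
  have joint: "distr M S X \<Otimes>\<^sub>M distr M T Y = distr M (S \<Otimes>\<^sub>M T) (\<lambda>\<omega>. (X \<omega>, Y \<omega>))"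
  proof (rule pair_measure_eqI)
    fix A B assume "A \<in> sets (distr M S X)" "B \<in> sets (distr M T Y)"
    then have AB: "A \<in> sets S" "B \<in> sets T" by auto
    have "(\<lambda>\<omega>. (X \<omega>, Y \<omega>)) -` (A \<times> B) \<inter> space M = (X -` A \<inter> space M) \<inter> (Y -` B \<inter> space M)" by auto
    moreover have "prob ((X -` A \<inter> space M) \<inter> (Y -` B \<inter> space M)) = prob (X -` A \<inter> space M) * prob (Y -` B \<inter> space M)"
      using AB by (intro indep_setD[OF indep]) auto
    ultimately show "emeasure (distr M S X) A * emeasure (distr M T Y) B = emeasure (distr M (S \<Otimes>\<^sub>M T) (\<lambda>\<omega>. (X \<omega>, Y \<omega>))) (A \<times> B)"
      using AB by (simp add: emeasure_distr emeasure_eq_measure ennreal_mult)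
  qed (auto intro: X.sigma_finite_measure_axioms Y.sigma_finite_measure_axioms)
  have "(\<integral>\<^sup>+\<omega>. h (X \<omega>, Y \<omega>) \<partial>M) = integral\<^sup>N (distr M S X \<Otimes>\<^sub>M distr M T Y) h"
    unfolding joint by (simp add: nn_integral_distr)
  also have "\<dots> = (\<integral>\<^sup>+y. (\<integral>\<^sup>+x. h (x, y) \<partial>distr M S X) \<partial>distr M T Y)"
    by (rule XY.nn_integral_snd[symmetric]) simp
  also have "\<dots> = (\<integral>\<^sup>+\<omega>. (\<integral>\<^sup>+x. h (x, Y \<omega>) \<partial>distr M S X) \<partial>M)"
    by (rule nn_integral_distr) auto
  also have "\<dots> = (\<integral>\<^sup>+\<omega>. (\<integral>\<^sup>+\<omega>'. h (X \<omega>', Y \<omega>) \<partial>M) \<partial>M)"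
  proof (rule nn_integral_cong)
    fix \<omega> assume "\<omega> \<in> space M"
    then have [measurable]: "Y \<omega> \<in> space T" by (rule measurable_space[OF assms(2)])
    show "(\<integral>\<^sup>+x. h (x, Y \<omega>) \<partial>distr M S X) = (\<integral>\<^sup>+\<omega>'. h (X \<omega>', Y \<omega>) \<partial>M)"
      by (rule nn_integral_distr) auto
  qed
  finally show ?thesis .
qed

section \<open>Moments of the random switching signal\<close>

locale EH_signal = prob_space M for M :: "'w measure" +
  fixes N \<sigma>\<^sub>0 :: nat and \<sigma> :: "real \<Rightarrow> 'w \<Rightarrow> nat" and \<tau> :: "nat \<Rightarrow> 'w \<Rightarrow> real"
    and rate :: real and q :: "nat \<Rightarrow> real"
  assumes signal: "switching_signal N \<sigma>\<^sub>0 \<sigma> \<tau>"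
    and EH: "class_EH N rate q \<sigma> \<tau>"
begin

lemma rate: "rate > 0"
  using EH by (simp add: class_EH_def)

lemma mode_at_measurable [measurable]: "random_variable (count_space UNIV) (mode_at \<sigma> \<tau> j)"
  using EH by (simp add: class_EH_def)

lemma holding_time_measurable [measurable]: "holding_time \<tau> j \<in> borel_measurable M"
proof -
  have "\<And>i. \<tau> i \<in> borel_measurable M" using signal by (simp add: switching_signal_def)
  then show ?thesis unfolding holding_time_def by measurable
qed

lemma holding_time_distributed:
  assumes "i \<ge> 1"
  shows "distributed M lborel (holding_time \<tau> i) (exponential_density rate)"
  using EH assms unfolding exponential_distributed_iff[OF rate] class_EH_def
  by (simp add: mult.commute)

lemma nn_integral_prod_exp_holding_time:
  assumes c: "\<And>k. k < n \<Longrightarrow> rate + c k > 0"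
  shows "(\<integral>\<^sup>+\<omega>. (\<Prod>k<n. ennreal (exp (- c k * holding_time \<tau> (Suc k) \<omega>))) \<partial>M) = (\<Prod>k<n. ennreal (rate / (rate + c k)))"
proof -
  \<comment> \<open>Holding times are numbered from 1 and the coefficients from 0, hence
    \<open>i - 1\<close>.\<close>
  define X where "X i \<omega> = ennreal (exp (- c (i - 1) * holding_time \<tau> i \<omega>))" for i \<omega>
  have "indep_vars (\<lambda>_. borel) (holding_time \<tau>) {1..}" using EH by (simp add: class_EH_def)
  then have "indep_vars (\<lambda>_. borel) (holding_time \<tau>) {1..n}" by (rule indep_vars_subset) auto
  then have "indep_vars (\<lambda>_. borel) (\<lambda>i \<omega>. (\<lambda>s. ennreal (exp (- c (i - 1) * s))) (holding_time \<tau> i \<omega>)) {1..n}"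
    by (rule indep_vars_compose2) simp
  then have "indep_vars (\<lambda>_. borel) X {1..n}" by (simp add: X_def[abs_def])
  then have "(\<integral>\<^sup>+\<omega>. (\<Prod>i\<in>{1..n}. X i \<omega>) \<partial>M) = (\<Prod>i\<in>{1..n}. \<integral>\<^sup>+\<omega>. X i \<omega> \<partial>M)"
    by (intro indep_vars_nn_integral) auto
  also have "\<dots> = (\<Prod>i\<in>{1..n}. ennreal (rate / (rate + c (i - 1))))"
  proof (rule prod.cong[OF refl])
    fix i assume "i \<in> {1..n}"
    then show "(\<integral>\<^sup>+\<omega>. X i \<omega> \<partial>M) = ennreal (rate / (rate + c (i - 1)))"
      unfolding X_def using c[of "i - 1"]
      by (intro nn_integral_exponential_distributed_exp holding_time_distributed rate) auto
  qed
  finally show ?thesis by (simp add: prod.atLeast1_atMost_eq X_def)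
qed

lemma AE_path:
  "AE \<omega> in M. \<tau> 0 \<omega> = 0 \<and> (\<forall>i. \<tau> i \<omega> < \<tau> (Suc i) \<omega>) \<and>
        (\<forall>i. \<forall>t\<in>{\<tau> i \<omega>..<\<tau> (Suc i) \<omega>}. \<sigma> t \<omega> = \<sigma> (\<tau> i \<omega>) \<omega>)"
  using signal by (simp add: switching_signal_def)

lemma signal_in_modes: "\<omega> \<in> space M \<Longrightarrow> t \<ge> 0 \<Longrightarrow> \<sigma> t \<omega> \<in> {1..N}"
  using signal measurable_space[of "\<sigma> t" M "count_space {1..N}" \<omega>] by (simp add: switching_signal_def)

text \<open>The signal is known to take values in \<open>{1..N}\<close> at nonnegative times only,
  and switching instants are nonnegative only almost surely.\<close>

lemma AE_mode_at: "AE \<omega> in M. \<forall>k. mode_at \<sigma> \<tau> k \<omega> \<in> {1..N}"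
  using AE_path AE_space
proof eventually_elim
  case (elim \<omega>)
  have "\<tau> 0 \<omega> \<le> \<tau> k \<omega>" for k by (rule lift_Suc_mono_le[of "\<lambda>k. \<tau> k \<omega>"]) (use elim less_imp_le in auto)
  then show ?case using elim signal_in_modes unfolding mode_at_def by metis
qed

text \<open>The product of the \<open>exp (- S)\<close> telescopes to
  \<open>exp (- \<tau> n)\<close>, and its mean is a geometric sequence with ratio
  \<open>rate / (rate + 1)\<close>. It therefore tends to 0 almost surely, which says that the
  switching instants are unbounded.\<close>

lemma AE_tau_at_top: "AE \<omega> in M. filterlim (\<lambda>n. \<tau> n \<omega>) at_top sequentially"
proof -
  define X where "X n \<omega> = (\<Prod>k<n. exp (- 1 * holding_time \<tau> (Suc k) \<omega>))" for n \<omega>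
  have "(\<integral>\<^sup>+\<omega>. ennreal (X n \<omega>) \<partial>M) = ennreal ((rate / (rate + 1)) ^ n)" for n
    using nn_integral_prod_exp_holding_time[of n "\<lambda>_. 1"] rate
    by (simp add: X_def prod_ennreal ennreal_power)
  moreover have "summable (\<lambda>n. (rate / (rate + 1)) ^ n)" using rate by (intro summable_geometric) simp
  ultimately have "(\<Sum>n. \<integral>\<^sup>+\<omega>. ennreal (X n \<omega>) \<partial>M) \<noteq> \<infinity>"
    using rate by (simp add: ennreal_suminf_neq_top)
  then have "AE \<omega> in M. (\<lambda>n. X n \<omega>) \<longlonglongrightarrow> 0"
    by (intro AE_tendsto_zero_if_summable_nn_integral) (auto simp: X_def intro: prod_nonneg)
  then show ?thesis using AE_path
  proof eventually_elim
    case (elim \<omega>)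
    have X: "X n \<omega> = exp (- \<tau> n \<omega>)" for n
    proof -
      have "X n \<omega> = exp (- (\<Sum>k<n. \<tau> (Suc k) \<omega> - \<tau> k \<omega>))"
        by (simp add: X_def holding_time_def exp_sum flip: sum_negf)
      then show ?thesis using elim(2) sum_lessThan_telescope[of "\<lambda>k. \<tau> k \<omega>" n] by simp
    qed
    show ?case
      unfolding filterlim_at_top_dense
    proof
      fix Z :: real
      have "\<forall>\<^sub>F n in sequentially. X n \<omega> < exp (- Z)"
        by (rule order_tendstoD(2)[OF elim(1)]) simp
      then show "\<forall>\<^sub>F n in sequentially. Z < \<tau> n \<omega>" by (simp add: X)
    qed
  qed
qed

lemma mode_map_measurable: "(\<lambda>\<omega>. \<lambda>k\<in>{..<n}. mode_at \<sigma> \<tau> k \<omega>) \<in> measurable M (\<Pi>\<^sub>M k\<in>{..<n}. count_space UNIV)"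
  by measurable

lemma subalgebra_mode_history: "subalgebra M (mode_history \<sigma> \<tau> n)"
  unfolding subalgebra_def mode_history_def
  using measurable_sets[OF mode_map_measurable[of n]] measurable_space[OF mode_map_measurable[of n]]
  by (auto simp: sets_vimage_algebra2 Pi_iff)

text \<open>The product over earlier modes is a function of \<open>mode_history\<close>, so it comes
  out of the conditional expectation, and the last mode contributes the constants
  \<open>q i\<close>. Vanishing of \<open>g\<close> off \<open>{1..N}\<close> lets the last factor
  be expanded over these modes at every \<omega>. The law is prescribed from index 1 on, whence
  \<open>n \<ge> 1\<close>.\<close>

lemma expectation_prod_modes_Suc:
  fixes g :: "nat \<Rightarrow> real"
  assumes out: "\<And>i. i \<notin> {1..N} \<Longrightarrow> g i = 0" and n: "n \<ge> 1"
  shows "expectation (\<lambda>\<omega>. \<Prod>k<Suc n. g (mode_at \<sigma> \<tau> k \<omega>))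
       = (\<Sum>i\<in>{1..N}. g i * q i) * expectation (\<lambda>\<omega>. \<Prod>k<n. g (mode_at \<sigma> \<tau> k \<omega>))"
proof -
  let ?F = "mode_history \<sigma> \<tau> n"
  interpret F: finite_measure_subalgebra M ?F
    by unfold_locales (rule subalgebra_mode_history)
  define Y where "Y \<omega> = (\<Prod>k<n. g (mode_at \<sigma> \<tau> k \<omega>))" for \<omega>
  define D where "D i = {\<omega>\<in>space M. mode_at \<sigma> \<tau> n \<omega> = i}" for i
  have D [measurable]: "D i \<in> sets M" for i unfolding D_def by measurable
  define C where "C = (\<Sum>i\<in>{1..N}. \<bar>g i\<bar>)"
  have C: "\<bar>g i\<bar> \<le> C" for i
  proof (cases "i \<in> {1..N}")
    case True
    then show ?thesis unfolding C_def by (intro member_le_sum) auto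
  next
    case False
    then show ?thesis using out by (auto simp: C_def intro: sum_nonneg)
  qed
  have Y_bound: "norm (Y \<omega>) \<le> C ^ n" for \<omega>
  proof -
    have "norm (Y \<omega>) = (\<Prod>k<n. \<bar>g (mode_at \<sigma> \<tau> k \<omega>)\<bar>)" by (simp add: Y_def abs_prod)
    also have "\<dots> \<le> (\<Prod>k<n. C)" using C by (intro prod_mono) auto
    finally show ?thesis by simp
  qed
  have YF: "Y \<in> borel_measurable ?F"
  proof -
    have "(\<lambda>\<omega>. \<lambda>k\<in>{..<n}. mode_at \<sigma> \<tau> k \<omega>) \<in> measurable ?F (\<Pi>\<^sub>M k\<in>{..<n}. count_space UNIV)"
      unfolding mode_history_def
      by (rule measurable_vimage_algebra1) (auto simp: space_PiM)
    moreover have "(\<lambda>f. \<Prod>k<n. g (f k)) \<in> borel_measurable (\<Pi>\<^sub>M k\<in>{..<n}. count_space UNIV)"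
      by measurable
    ultimately have "(\<lambda>\<omega>. \<Prod>k<n. g ((\<lambda>k\<in>{..<n}. mode_at \<sigma> \<tau> k \<omega>) k)) \<in> borel_measurable ?F"
      by (rule measurable_compose)
    also have "(\<lambda>\<omega>. \<Prod>k<n. g ((\<lambda>k\<in>{..<n}. mode_at \<sigma> \<tau> k \<omega>) k)) = Y"
      by (auto simp: Y_def fun_eq_iff intro: prod.cong)
    finally show ?thesis .
  qed
  then have [measurable]: "Y \<in> borel_measurable M"
    by (rule measurable_from_subalg[OF subalgebra_mode_history])
  have intY: "integrable M (\<lambda>\<omega>. Y \<omega> * indicator (D i) \<omega>)" for i
    by (rule integrable_const_bound[of _ "C ^ n"]) (use Y_bound in \<open>auto simp: indicator_def intro: order_trans[OF _ Y_bound]\<close>)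
  have step: "expectation (\<lambda>\<omega>. Y \<omega> * indicator (D i) \<omega>) = expectation Y * q i" if i: "i \<in> {1..N}" for i
  proof -
    have "AE \<omega> in M. real_cond_exp M ?F (indicator (D i)) \<omega> = q i"
      using EH n i unfolding class_EH_def D_def by auto
    then have "expectation (\<lambda>\<omega>. Y \<omega> * real_cond_exp M ?F (indicator (D i)) \<omega>) = expectation (\<lambda>\<omega>. Y \<omega> * q i)"
      by (intro integral_cong_AE) auto
    then show ?thesis
      using F.real_cond_exp_intg(2)[OF intY YF, of i] by simp
  qed
  have "(\<Prod>k<Suc n. g (mode_at \<sigma> \<tau> k \<omega>)) = (\<Sum>i\<in>{1..N}. g i * (Y \<omega> * indicator (D i) \<omega>))" if "\<omega> \<in> space M" for \<omega>
  proof -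
    have "(\<Sum>i\<in>{1..N}. g i * (Y \<omega> * indicator (D i) \<omega>)) = (\<Sum>i\<in>{1..N}. if mode_at \<sigma> \<tau> n \<omega> = i then g i * Y \<omega> else 0)"
      using that by (intro sum.cong) (auto simp: D_def)
    also have "\<dots> = g (mode_at \<sigma> \<tau> n \<omega>) * Y \<omega>"
      using out by (auto simp: sum.delta')
    finally show ?thesis by (simp add: Y_def)
  qed
  then have "expectation (\<lambda>\<omega>. \<Prod>k<Suc n. g (mode_at \<sigma> \<tau> k \<omega>)) = expectation (\<lambda>\<omega>. \<Sum>i\<in>{1..N}. g i * (Y \<omega> * indicator (D i) \<omega>))"
    by (intro Bochner_Integration.integral_cong refl)
  also have "\<dots> = (\<Sum>i\<in>{1..N}. g i * expectation (\<lambda>\<omega>. Y \<omega> * indicator (D i) \<omega>))"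
    using intY by (simp add: Bochner_Integration.integral_sum)
  also have "\<dots> = (\<Sum>i\<in>{1..N}. g i * (expectation Y * q i))"
    using step by (intro sum.cong) auto
  also have "\<dots> = (\<Sum>i\<in>{1..N}. g i * q i) * expectation Y"
    unfolding sum_distrib_right by (simp add: mult_ac)
  also have "expectation Y = expectation (\<lambda>\<omega>. \<Prod>k<n. g (mode_at \<sigma> \<tau> k \<omega>))"
    by (simp add: Y_def[abs_def])
  finally show ?thesis .
qed

text \<open>There are \<open>n + 1\<close> factors but only the power \<open>n\<close>: the initial
  mode does not follow \<open>q\<close>.\<close>

lemma expectation_prod_modes:
  fixes g :: "nat \<Rightarrow> real"
  assumes out: "\<And>i. i \<notin> {1..N} \<Longrightarrow> g i = 0"
  shows "expectation (\<lambda>\<omega>. \<Prod>k<Suc n. g (mode_at \<sigma> \<tau> k \<omega>))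
       = (\<Sum>i\<in>{1..N}. g i * q i) ^ n * expectation (\<lambda>\<omega>. g (mode_at \<sigma> \<tau> 0 \<omega>))"
proof (induction n)
  case (Suc n)
  then show ?case using expectation_prod_modes_Suc[of g "Suc n", OF out] by (simp del: prod.lessThan_Suc)
qed simp

lemma AE_gain_tendsto_zero:
  fixes lam :: "nat \<Rightarrow> real" and \<mu> :: real
  assumes mu: "\<mu> > 0" and pos: "\<And>i. i \<in> {1..N} \<Longrightarrow> lam i + rate > 0"
    and contr: "(\<Sum>i\<in>{1..N}. \<mu> * q i / (1 + lam i / rate)) < 1"
  shows "AE \<omega> in M. (\<lambda>n. \<Prod>k<n. \<mu> * exp (- lam (\<sigma> (\<tau> k \<omega>) \<omega>) * (\<tau> (Suc k) \<omega> - \<tau> k \<omega>))) \<longlonglongrightarrow> 0"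
proof -
  \<comment> \<open>\<open>g i\<close> is the mean of \<open>H i\<close> at an exponential time.
    Both are set to 0 off \<open>{1..N}\<close>, so the identities below hold for every \<omega>,
    and \<open>Z\<close> agrees with the gain almost surely.\<close>
  define g where "g i = (if i \<in> {1..N} then \<mu> * (rate / (rate + lam i)) else 0)" for i
  define H where "H i s = (if i \<in> {1..N} then \<mu> * exp (- lam i * s) else 0)" for i s
  define Z where "Z n \<omega> = (\<Prod>k<n. H (mode_at \<sigma> \<tau> k \<omega>) (holding_time \<tau> (Suc k) \<omega>))" for n \<omega>
  have g0: "g i \<ge> 0" for i using mu rate pos[of i] by (auto simp: g_def)
  have H0: "H i s \<ge> 0" for i s using mu by (auto simp: H_def)
  have Hm [measurable]: "H i \<in> borel_measurable borel" for i unfolding H_def by measurable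
  define \<eta> where "\<eta> = (\<Sum>i\<in>{1..N}. g i * q i)"
  have "\<eta> = (\<Sum>i\<in>{1..N}. \<mu> * q i / (1 + lam i / rate))"
    unfolding \<eta>_def
  proof (rule sum.cong[OF refl])
    fix i assume "i \<in> {1..N}"
    then show "g i * q i = \<mu> * q i / (1 + lam i / rate)"
      using pos[of i] rate by (simp add: g_def field_simps)
  qed
  then have \<eta>1: "\<eta> < 1" using contr by simp
  have \<eta>0: "\<eta> \<ge> 0"
    unfolding \<eta>_def using g0 EH by (intro sum_nonneg mult_nonneg_nonneg) (auto simp: class_EH_def)
  let ?S = "\<Pi>\<^sub>M i\<in>{1::nat..}. borel :: real measure" and ?T = "\<Pi>\<^sub>M j\<in>(UNIV::nat set). count_space (UNIV::nat set)"
  define X where "X \<omega> = (\<lambda>i\<in>{1..}. holding_time \<tau> i \<omega>)" for \<omega>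
  define Y where "Y \<omega> = (\<lambda>j. mode_at \<sigma> \<tau> j \<omega>)" for \<omega>
  have X [measurable]: "X \<in> measurable M ?S" unfolding X_def by measurable
  have Y [measurable]: "Y \<in> measurable M ?T"
    unfolding Y_def by (rule measurable_PiM_single') (auto simp: space_PiM)
  have indep: "indep_set {X -` A \<inter> space M | A. A \<in> sets ?S} {Y -` A \<inter> space M | A. A \<in> sets ?T}"
  proof -
    have "indep_set (sets (vimage_algebra (space M) X ?S)) (sets (vimage_algebra (space M) Y ?T))"
      using EH unfolding class_EH_def X_def[abs_def] Y_def[abs_def] by blast
    then show ?thesis
      using measurable_space[OF X] measurable_space[OF Y]
      by (simp add: sets_vimage_algebra2 Pi_iff)
  qed
  \<comment> \<open>The modes are frozen at \<omega> while the holding times run over an independent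
    \<omega>', so the exponents are constants here.\<close>
  have inner: "(\<integral>\<^sup>+\<omega>'. ennreal (\<Prod>k<n. H (mode_at \<sigma> \<tau> k \<omega>) (holding_time \<tau> (Suc k) \<omega>')) \<partial>M)
      = ennreal (\<Prod>k<n. g (mode_at \<sigma> \<tau> k \<omega>))" for \<omega> n
  proof (cases "\<forall>k<n. mode_at \<sigma> \<tau> k \<omega> \<in> {1..N}")
    case True
    let ?c = "\<lambda>k. lam (mode_at \<sigma> \<tau> k \<omega>)"
    have "(\<integral>\<^sup>+\<omega>'. ennreal (\<Prod>k<n. H (mode_at \<sigma> \<tau> k \<omega>) (holding_time \<tau> (Suc k) \<omega>')) \<partial>M)
        = (\<integral>\<^sup>+\<omega>'. ennreal (\<mu> ^ n) * (\<Prod>k<n. ennreal (exp (- ?c k * holding_time \<tau> (Suc k) \<omega>'))) \<partial>M)"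
    proof (rule nn_integral_cong)
      fix \<omega>'
      have "(\<Prod>k<n. H (mode_at \<sigma> \<tau> k \<omega>) (holding_time \<tau> (Suc k) \<omega>'))
          = (\<Prod>k<n. \<mu> * exp (- ?c k * holding_time \<tau> (Suc k) \<omega>'))"
        using True by (intro prod.cong) (auto simp: H_def)
      then show "ennreal (\<Prod>k<n. H (mode_at \<sigma> \<tau> k \<omega>) (holding_time \<tau> (Suc k) \<omega>'))
          = ennreal (\<mu> ^ n) * (\<Prod>k<n. ennreal (exp (- ?c k * holding_time \<tau> (Suc k) \<omega>')))"
        using mu by (simp add: prod.distrib prod_ennreal ennreal_mult prod_nonneg)
    qed
    also have "\<dots> = ennreal (\<mu> ^ n) * (\<integral>\<^sup>+\<omega>'. (\<Prod>k<n. ennreal (exp (- ?c k * holding_time \<tau> (Suc k) \<omega>'))) \<partial>M)"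
      by (rule nn_integral_cmult) measurable
    also have "(\<integral>\<^sup>+\<omega>'. (\<Prod>k<n. ennreal (exp (- ?c k * holding_time \<tau> (Suc k) \<omega>'))) \<partial>M) = (\<Prod>k<n. ennreal (rate / (rate + ?c k)))"
      by (rule nn_integral_prod_exp_holding_time) (use pos True in \<open>auto simp: add.commute\<close>)
    also have "ennreal (\<mu> ^ n) * (\<Prod>k<n. ennreal (rate / (rate + ?c k))) = ennreal (\<Prod>k<n. \<mu> * (rate / (rate + ?c k)))"
    proof -
      have nonneg: "rate / (rate + ?c k) \<ge> 0" if "k < n" for k
        using pos[of "mode_at \<sigma> \<tau> k \<omega>"] True that rate by auto
      then have "(\<Prod>k<n. ennreal (rate / (rate + ?c k))) = ennreal (\<Prod>k<n. rate / (rate + ?c k))"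
        by (intro prod_ennreal) auto
      moreover have "(\<Prod>k<n. rate / (rate + ?c k)) \<ge> 0"
        using nonneg by (intro prod_nonneg) auto
      moreover have "(\<Prod>k<n. \<mu> * (rate / (rate + ?c k))) = \<mu> ^ n * (\<Prod>k<n. rate / (rate + ?c k))"
        by (simp only: prod.distrib prod_constant card_lessThan)
      ultimately show ?thesis using mu by (simp only: ennreal_mult zero_le_power less_imp_le)
    qed
    also have "(\<Prod>k<n. \<mu> * (rate / (rate + ?c k))) = (\<Prod>k<n. g (mode_at \<sigma> \<tau> k \<omega>))"
      using True by (intro prod.cong) (auto simp: g_def)
    finally show ?thesis .
  next
    case False
    then obtain k where k: "k < n" "mode_at \<sigma> \<tau> k \<omega> \<notin> {1..N}" by blast
    then have "(\<Prod>k<n. g (mode_at \<sigma> \<tau> k \<omega>)) = 0"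
      by (intro prod_zero) (auto simp: g_def)
    moreover have "(\<Prod>k<n. H (mode_at \<sigma> \<tau> k \<omega>) (holding_time \<tau> (Suc k) \<omega>')) = 0" for \<omega>'
      using k by (intro prod_zero) (auto simp: H_def)
    ultimately show ?thesis by (simp only: ennreal_0 nn_integral_const mult_zero_left)
  qed
  have moment: "(\<integral>\<^sup>+\<omega>. ennreal (Z n \<omega>) \<partial>M) = (\<integral>\<^sup>+\<omega>. ennreal (\<Prod>k<n. g (mode_at \<sigma> \<tau> k \<omega>)) \<partial>M)" for n
  proof -
    define h where "h = (\<lambda>(x, y). ennreal (\<Prod>k<n. H (y k) (x (Suc k))))"
    \<comment> \<open>\<open>H\<close> is measurable in its time argument for each mode;
      countability of the modes gives joint measurability.\<close>
    have [measurable]: "(\<lambda>p. H (snd p k) (fst p (Suc k))) \<in> borel_measurable (?S \<Otimes>\<^sub>M ?T)" for k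
      by (rule measurable_compose_countable[where f = "\<lambda>i p. H i (fst p (Suc k))" and g = "\<lambda>p. snd p k"]) measurable
    have [measurable]: "h \<in> borel_measurable (?S \<Otimes>\<^sub>M ?T)"
      unfolding h_def case_prod_beta by measurable
    have "(\<integral>\<^sup>+\<omega>. ennreal (Z n \<omega>) \<partial>M) = (\<integral>\<^sup>+\<omega>. h (X \<omega>, Y \<omega>) \<partial>M)"
      by (simp add: Z_def h_def X_def Y_def)
    also have "\<dots> = (\<integral>\<^sup>+\<omega>. (\<integral>\<^sup>+\<omega>'. h (X \<omega>', Y \<omega>) \<partial>M) \<partial>M)"
      by (rule nn_integral_indep_pair[OF X Y indep]) measurable
    also have "\<dots> = (\<integral>\<^sup>+\<omega>. ennreal (\<Prod>k<n. g (mode_at \<sigma> \<tau> k \<omega>)) \<partial>M)"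
      by (simp add: h_def X_def Y_def inner)
    finally show ?thesis .
  qed
  define c where "c = expectation (\<lambda>\<omega>. g (mode_at \<sigma> \<tau> 0 \<omega>))"
  have c0: "c \<ge> 0" unfolding c_def using g0 by simp
  \<comment> \<open>The index starts at \<open>Suc n\<close> because one factor belongs to the
    initial mode and is absorbed in \<open>c\<close>; shifting by one does not affect the
    limit.\<close>
  have "(\<integral>\<^sup>+\<omega>. ennreal (Z (Suc n) \<omega>) \<partial>M) = ennreal (\<eta> ^ n * c)" for n
  proof -
    have "integrable M (\<lambda>\<omega>. \<Prod>k<Suc n. g (mode_at \<sigma> \<tau> k \<omega>))"
    proof (rule integrable_const_bound[of _ "(\<Sum>i\<in>{1..N}. g i) ^ Suc n"])
      have gb: "g i \<le> (\<Sum>i\<in>{1..N}. g i)" for i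
      proof (cases "i \<in> {1..N}")
        case True
        then show ?thesis using g0 by (intro member_le_sum) auto
      next
        case False
        then have "g i = 0" by (auto simp: g_def)
        then show ?thesis using g0 by (auto intro: sum_nonneg)
      qed
      have "norm (\<Prod>k<Suc n. g (mode_at \<sigma> \<tau> k \<omega>)) \<le> (\<Sum>i\<in>{1..N}. g i) ^ Suc n" for \<omega>
      proof -
        have "norm (\<Prod>k<Suc n. g (mode_at \<sigma> \<tau> k \<omega>)) = (\<Prod>k<Suc n. g (mode_at \<sigma> \<tau> k \<omega>))"
          using g0 by (simp only: real_norm_def abs_of_nonneg prod_nonneg)
        also have "\<dots> \<le> (\<Prod>k<Suc n. (\<Sum>i\<in>{1..N}. g i))" using g0 gb by (intro prod_mono) auto
        finally show ?thesis by simp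
      qed
      then show "AE \<omega> in M. norm (\<Prod>k<Suc n. g (mode_at \<sigma> \<tau> k \<omega>)) \<le> (\<Sum>i\<in>{1..N}. g i) ^ Suc n" by blast
      show "(\<lambda>\<omega>. \<Prod>k<Suc n. g (mode_at \<sigma> \<tau> k \<omega>)) \<in> borel_measurable M" by measurable
    qed
    then have "(\<integral>\<^sup>+\<omega>. ennreal (\<Prod>k<Suc n. g (mode_at \<sigma> \<tau> k \<omega>)) \<partial>M) = ennreal (expectation (\<lambda>\<omega>. \<Prod>k<Suc n. g (mode_at \<sigma> \<tau> k \<omega>)))"
      by (rule nn_integral_eq_integral) (use g0 in \<open>auto intro!: prod_nonneg mult_nonneg_nonneg\<close>)
    moreover have "expectation (\<lambda>\<omega>. \<Prod>k<Suc n. g (mode_at \<sigma> \<tau> k \<omega>)) = \<eta> ^ n * c"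
      unfolding \<eta>_def c_def by (rule expectation_prod_modes) (simp only: g_def if_False)
    ultimately show ?thesis by (simp only: moment)
  qed
  moreover have "summable (\<lambda>n. \<eta> ^ n * c)" using \<eta>0 \<eta>1 by (intro summable_mult2 summable_geometric) simp
  ultimately have "(\<Sum>n. \<integral>\<^sup>+\<omega>. ennreal (Z (Suc n) \<omega>) \<partial>M) \<noteq> \<infinity>"
    using \<eta>0 c0 by (simp add: ennreal_suminf_neq_top)
  moreover have "Z n \<in> borel_measurable M" for n
  proof -
    have "(\<lambda>\<omega>. H (mode_at \<sigma> \<tau> k \<omega>) (holding_time \<tau> (Suc k) \<omega>)) \<in> borel_measurable M" for k
      by (rule measurable_compose_countable[where f = "\<lambda>i \<omega>. H i (holding_time \<tau> (Suc k) \<omega>)"]) measurable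
    then show ?thesis unfolding Z_def by measurable
  qed
  ultimately have "AE \<omega> in M. (\<lambda>n. Z (Suc n) \<omega>) \<longlonglongrightarrow> 0"
    by (intro AE_tendsto_zero_if_summable_nn_integral) (auto simp: Z_def H0 intro!: prod_nonneg mult_nonneg_nonneg)
  then show ?thesis using AE_mode_at
  proof eventually_elim
    case (elim \<omega>)
    have "Z n \<omega> = (\<Prod>k<n. \<mu> * exp (- lam (\<sigma> (\<tau> k \<omega>) \<omega>) * (\<tau> (Suc k) \<omega> - \<tau> k \<omega>)))" for n
      unfolding Z_def using elim(2)
      by (intro prod.cong) (auto simp: H_def holding_time_def mode_at_def)
    then show ?case using LIMSEQ_imp_Suc[OF elim(1)] by simp
  qed
qed

end

section \<open>From single paths to almost sure stability\<close>

theorem theorem3p2: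
  fixes M :: "'w measure"
    and N \<sigma>\<^sub>0 :: nat
    and f :: "nat \<Rightarrow> real ^ 'n \<Rightarrow> real ^ 'n"
    and \<sigma> :: "real \<Rightarrow> 'w \<Rightarrow> nat"
    and \<tau> :: "nat \<Rightarrow> 'w \<Rightarrow> real"
    and V :: "nat \<Rightarrow> real ^ 'n \<Rightarrow> real"
    and gradV :: "nat \<Rightarrow> real ^ 'n \<Rightarrow> real ^ 'n"
    and \<alpha>\<^sub>1 \<alpha>\<^sub>2 :: "real \<Rightarrow> real"
    and \<mu> rate :: real
    and lam q :: "nat \<Rightarrow> real"
  assumes probability_space: "prob_space M" "complete_measure M"
    and vector_fields: "\<And>i. i \<in> {1..N} \<Longrightarrow> locally_lipschitz (f i) \<and> f i 0 = 0"
    and signal: "prob_space.switching_signal M N \<sigma>\<^sub>0 \<sigma> \<tau>"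
    and E1_C1: "\<And>i. i \<in> {1..N} \<Longrightarrow> has_continuous_gradient (V i) (gradV i)"
    and E1_K: "class_K_inf \<alpha>\<^sub>1" "class_K_inf \<alpha>\<^sub>2"
    and E1_mu: "\<mu> > 1"
    and E1_bounds: "\<And>i x. i \<in> {1..N} \<Longrightarrow> \<alpha>\<^sub>1 (norm x) \<le> V i x \<and> V i x \<le> \<alpha>\<^sub>2 (norm x)"
    and E1_decay: "\<And>i x. i \<in> {1..N} \<Longrightarrow> gradV i x \<bullet> f i x \<le> - lam i * V i x"
    and E1_compare: "\<And>i j x. i \<in> {1..N} \<Longrightarrow> j \<in> {1..N} \<Longrightarrow> V i x \<le> \<mu> * V j x"
    and E2: "prob_space.class_EH M N rate q \<sigma> \<tau>"
    and E3: "\<And>i. i \<in> {1..N} \<Longrightarrow> lam i + rate > 0"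
    and E4: "(\<Sum>i\<in>{1..N}. \<mu> * q i / (1 + lam i / rate)) < 1"
  shows "globally_asymptotically_stable_as M f \<sigma>"
proof -
  interpret prob_space M by (rule probability_space(1))
  interpret EH_signal M N \<sigma>\<^sub>0 \<sigma> \<tau> rate q
    by unfold_locales (use signal E2 in auto)
  have "AE \<omega> in M. switched_path f V gradV \<alpha>\<^sub>1 \<alpha>\<^sub>2 \<mu> lam N (\<lambda>t. \<sigma> t \<omega>) (\<lambda>n. \<tau> n \<omega>)"
    using AE_path AE_tau_at_top AE_space
  proof eventually_elim
    case (elim \<omega>)
    show ?case
    proof
      show "\<sigma> t \<omega> = \<sigma> (\<tau> n \<omega>) \<omega>" if "\<tau> n \<omega> \<le> t" "t < \<tau> (Suc n) \<omega>" for n t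
        using elim(1) that by auto
      show "\<sigma> t \<omega> \<in> {1..N}" if "t \<ge> 0" for t
        using signal_in_modes[OF elim(3) that] .
    qed (use elim vector_fields E1_C1 E1_K E1_mu E1_bounds E1_decay E1_compare in auto)
  qed
  moreover have "AE \<omega> in M. (\<lambda>n. \<Prod>k<n. \<mu> * exp (- lam (\<sigma> (\<tau> k \<omega>) \<omega>) * (\<tau> (Suc k) \<omega> - \<tau> k \<omega>))) \<longlonglongrightarrow> 0"
    using E1_mu E3 E4 by (intro AE_gain_tendsto_zero) auto
  \<comment> \<open>This event of full measure involves no initial state, so the path lemmas apply
    on it to all initial states simultaneously.\<close>
  ultimately have path: "AE \<omega> in M. switched_path f V gradV \<alpha>\<^sub>1 \<alpha>\<^sub>2 \<mu> lam N (\<lambda>t. \<sigma> t \<omega>) (\<lambda>n. \<tau> n \<omega>) \<and>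
      switched_path.gain \<mu> lam (\<lambda>t. \<sigma> t \<omega>) (\<lambda>n. \<tau> n \<omega>) \<longlonglongrightarrow> 0"
  proof eventually_elim
    case (elim \<omega>)
    then show ?case by (simp add: switched_path.gain_def[OF elim(1), abs_def])
  qed
  have "stable_as M f \<sigma>"
    unfolding stable_as_def using path
  proof eventually_elim
    case (elim \<omega>)
    then show ?case using switched_path.stable by blast
  qed
  moreover have "globally_attractive_as M f \<sigma>"
    unfolding globally_attractive_as_def using path
  proof eventually_elim
    case (elim \<omega>)
    then show ?case using switched_path.attractive by blast
  qed
  ultimately show ?thesis
    unfolding globally_asymptotically_stable_as_def by blast
qed

end
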